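(* Let $1<\alpha<2$, $0\le p\le1$, let $c\ge0$ be a constant, $N\ge1$, and suppose the penalty parameters $\rho_\pm$ and penalty functions $Q_N^\pm$ satisfy $$\rho_{-}Q_N^{-}(x)=-\sum_{k=0}^{N}\frac{1}{\gamma_{k}^{0,0}}L_{k}(x)L_{k}(-1),\qquad \rho_{+}Q_N^{+}(x)=\sum_{k=0}^{N}\frac{1}{\gamma_{k}^{0,0}}L_{k}(x)L_{k}(1).$$ Let $u_N\in\mathbb{P}_N$ be the solution of the spectral penalty scheme (weight $\omega\equiv1$) $$\mathcal{A}^C_P(u_N,v)=\langle f,v\rangle+g_1\rho_-(Q_N^-,v)+g_2\rho_+(Q_N^+,v)\quad\forall v\in\mathbb{P}_N,$$ where $$\mathcal{A}^C_P(u,v)=-\Big(\frac{d}{dx}\,{}^C\mathcal{D}_p^{\alpha-1}u,v\Big)+c(u,v)+\rho_-\,{}^C\mathcal{D}_p^{\alpha-1}u(-1)\,(Q_N^-,v)+\rho_+\,{}^C\mathcal{D}_p^{\alpha-1}u(1)\,(Q_N^+,v).$$ Then there is a constant $C>0$ independent of $N$ such that $\mathcal{A}^C_P(u_N,u_N)\ge C\,\|u_N'\|_{J^{\alpha/2-1}(\Lambda)}^2$.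
   Context: $\Lambda=(-1,1)$, $(\cdot,\cdot)$ is the $L^2(\Lambda)$ inner product, $\mathbb{P}_N$ the polynomials of degree $\le N$, $L_k$ the Legendre polynomials and $\gamma_k^{0,0}=\int_{-1}^1L_k^2\,dx=2/(2k+1)$; $f$ is a given right-hand side and $g_1,g_2$ given Caputo fractional Neumann data. Let $\mu,\nu$ be real numbers with $\alpha-2\le\mu,\nu\le0$, $\mu+\nu=\alpha-2$, $p\sin(\pi\mu)=(1-p)\sin(\pi\nu)$, $C_{\alpha,p}:=(\sin\pi\mu+\sin\pi\nu)/\sin\pi\alpha$. For $\sigma>0$, ${}_{-1}I_x^{\sigma}v(x)=\frac{1}{\Gamma(\sigma)}\int_{-1}^x (x-y)^{\sigma-1}v(y)\,dy$, ${}_{x}I_1^{\sigma}v(x)=\frac{1}{\Gamma(\sigma)}\int_x^1 (y-x)^{\sigma-1}v(y)\,dy$. The two-sided Caputo derivative is ${}^C\mathcal{D}_p^{\alpha-1}u:=C_{\alpha,p}\big(p\,{}_{-1}I_x^{2-\alpha}u'+(1-p)\,{}_{x}I_1^{2-\alpha}u'\big)$ (i.e. $C_{\alpha,p}$ times $p$ times the left Caputo derivative minus $(1-p)$ times the right Caputo derivative of order $\alpha-1$). For $\sigma\ge0$, $\|w\|_{J^{-\sigma}(\Lambda)}:=\big\||\xi|^{-\sigma}\mathcal{F}^c(w)(\xi)\big\|_{L^2(\mathbb{R})}$ with $\mathcal{F}^c(w)(\xi):=\frac{1}{2\pi}\int_{-1}^1 w(x)e^{{\rm i}\xi x}\,dx$;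 here $\sigma=1-\alpha/2$. *)

theory Defs
  imports "HOL-Analysis.Analysis" "HOL-Computational_Algebra.Polynomial"
begin

fun legendre :: "nat \<Rightarrow> real \<Rightarrow> real" where
  "legendre 0 x = 1"
| "legendre (Suc 0) x = x"
| "legendre (Suc (Suc k)) x =
     ((2 * real k + 3) * x * legendre (Suc k) x - (real k + 1) * legendre k x) / (real k + 2)"

(* gamma_k^{0,0} = int_{-1}^1 L_k^2 = 2/(2k+1) *)
definition gamma00 :: "nat \<Rightarrow> real" where
  "gamma00 k = 2 / (2 * real k + 1)"

definition L2ip :: "(real \<Rightarrow> real) \<Rightarrow> (real \<Rightarrow> real) \<Rightarrow> real" where
  "L2ip u v = integral {-1..1} (\<lambda>x. u x * v x)"

definition leftI :: "real \<Rightarrow> (real \<Rightarrow> real) \<Rightarrow> real \<Rightarrow> real" where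
  "leftI \<sigma> v x = integral {-1..x} (\<lambda>y. (x - y) powr (\<sigma> - 1) * v y) / Gamma \<sigma>"

definition rightI :: "real \<Rightarrow> (real \<Rightarrow> real) \<Rightarrow> real \<Rightarrow> real" where
  "rightI \<sigma> v x = integral {x..1} (\<lambda>y. (y - x) powr (\<sigma> - 1) * v y) / Gamma \<sigma>"

definition Calp :: "real \<Rightarrow> real \<Rightarrow> real \<Rightarrow> real" where
  "Calp \<alpha> \<mu> \<nu> = (sin (pi * \<mu>) + sin (pi * \<nu>)) / sin (pi * \<alpha>)"

definition caputoD :: "real \<Rightarrow> real \<Rightarrow> real \<Rightarrow> real \<Rightarrow> (real \<Rightarrow> real) \<Rightarrow> real \<Rightarrow> real" where
  "caputoD \<alpha> p \<mu> \<nu> u x =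
     Calp \<alpha> \<mu> \<nu> * (p * leftI (2 - \<alpha>) (deriv u) x + (1 - p) * rightI (2 - \<alpha>) (deriv u) x)"

definition bilinA ::
  "real \<Rightarrow> real \<Rightarrow> real \<Rightarrow> real \<Rightarrow> real \<Rightarrow> real \<Rightarrow> real \<Rightarrow> (real \<Rightarrow> real) \<Rightarrow> (real \<Rightarrow> real)
    \<Rightarrow> (real \<Rightarrow> real) \<Rightarrow> (real \<Rightarrow> real) \<Rightarrow> real" where
  "bilinA \<alpha> p \<mu> \<nu> c \<rho>m \<rho>p Qm Qp u v =
     - L2ip (deriv (caputoD \<alpha> p \<mu> \<nu> u)) v + c * L2ip u v
     + \<rho>m * caputoD \<alpha> p \<mu> \<nu> u (-1) * L2ip Qm v
     + \<rho>p * caputoD \<alpha> p \<mu> \<nu> u 1 * L2ip Qp v"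

definition Fc :: "(real \<Rightarrow> real) \<Rightarrow> real \<Rightarrow> complex" where
  "Fc w \<xi> = integral {-1..1} (\<lambda>x. complex_of_real (w x) * exp (\<i> * complex_of_real (\<xi> * x)))
             / complex_of_real (2 * pi)"

definition Jneg_norm :: "real \<Rightarrow> (real \<Rightarrow> real) \<Rightarrow> real" where
  "Jneg_norm \<sigma> w = sqrt (integral UNIV (\<lambda>\<xi>. (\<bar>\<xi>\<bar> powr (- \<sigma>) * cmod (Fc w \<xi>))\<^sup>2))"

end

theory Submission
  imports Defs "HOL-Probability.Characteristic_Functions"
begin

text \<open>
  The right-hand sides defining the penalty terms are reproducing kernels of the polynomials of degree
  at most \<open>N\<close> at the two endpoints, so the penalty terms cancel exactly the boundary terms of an
  integration by parts, and \<open>\<A>(u, u)\<close> is the integral of the Caputo derivative against \<open>u'\<close> plus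
  \<open>c \<parallel>u\<parallel>\<^sup>2\<close>. With \<open>s = 2 - \<alpha>\<close>, the left and the right fractional integral contribute equally,
  each half of the Riesz energy with kernel \<open>|x - y|\<^sup>s\<^sup>-\<^sup>1 / \<Gamma>(s)\<close>. This kernel is a mixture of Gaussians
  \<open>exp (-t (x - y)\<^sup>2)\<close> with weight \<open>t\<^sup>a\<^sup>-\<^sup>1\<close>, \<open>a = (1 - s) / 2\<close>, and each Gaussian is the Fourier
  transform of a normal density. Hence the energy is an integral of the squared Fourier transform of \<open>u'\<close>
  against a positive weight, which is bounded below by a multiple of \<open>|\<xi>|\<^sup>-\<^sup>s\<close>.
\<close>

section \<open>Legendre polynomials\<close>

text \<open>The recursion as a formal polynomial, so that derivatives of \<open>legendre\<close> can
  be taken with \<open>pderiv\<close>.\<close>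

fun legendre_poly :: "nat \<Rightarrow> real poly" where
  "legendre_poly 0 = 1"
| "legendre_poly (Suc 0) = [:0, 1:]"
| "legendre_poly (Suc (Suc k)) =
     smult (1 / (real k + 2))
       (smult (2 * real k + 3) ([:0, 1:] * legendre_poly (Suc k)) - smult (real k + 1) (legendre_poly k))"

lemma poly_legendre_poly: "poly (legendre_poly k) x = legendre k x"
  by (induction k x rule: legendre.induct) (simp_all add: field_simps)

lemma legendre_DERIV:
  "(legendre k has_real_derivative poly (pderiv (legendre_poly k)) x) (at x)"
  using poly_DERIV[of "legendre_poly k" x] by (simp add: poly_legendre_poly[abs_def])

lemma continuous_on_legendre [continuous_intros]:
  "continuous_on S (legendre k)"
  using DERIV_continuous_on[OF DERIV_subset[OF legendre_DERIV]] by blast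

lemma legendre_at_1 [simp]: "legendre k 1 = 1"
  by (induction k "1::real" rule: legendre.induct) (simp_all add: field_simps)

lemma legendre_at_minus_1: "legendre k (-1) = (-1) ^ k"
  by (induction k "-1::real" rule: legendre.induct) (simp_all add: field_simps)

lemma legendre_recurrence:
  "(real k + 2) * legendre (Suc (Suc k)) x =
     (2 * real k + 3) * x * legendre (Suc k) x - (real k + 1) * legendre k x"
  by simp

text \<open>From here on the recursion enters only in the division-free form
  \<open>legendre_recurrence\<close>, which suits \<open>algebra\<close>.\<close>

declare legendre.simps(3) [simp del]

lemma poly_pderiv_legendre_poly_recurrence:
  "(real k + 2) * poly (pderiv (legendre_poly (Suc (Suc k)))) x =
     (2 * real k + 3) * (legendre (Suc k) x + x * poly (pderiv (legendre_poly (Suc k))) x)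
     - (real k + 1) * poly (pderiv (legendre_poly k)) x"
  by (simp add: pderiv_smult pderiv_diff pderiv_pCons poly_legendre_poly) (simp add: algebra_simps)

declare legendre_poly.simps(3) [simp del]

text \<open>The two classical derivative identities are proved together: the second one at
  \<open>Suc k\<close> rests on both at \<open>k\<close>.\<close>

lemma pderiv_legendre_step:
  "poly (pderiv (legendre_poly (Suc k))) x = 
     x * poly (pderiv (legendre_poly k)) x + (real k + 1) * legendre k x \<and>
   x * poly (pderiv (legendre_poly (Suc k))) x - poly (pderiv (legendre_poly k)) x =
     (real k + 1) * legendre (Suc k) x"
proof (induction k)
  case 0
  then show ?case by (simp add: pderiv_pCons)
next
  case (Suc k)
  define a where "a = poly (pderiv (legendre_poly k)) x"
  define b where "b = poly (pderiv (legendre_poly (Suc k))) x"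
  define d where "d = poly (pderiv (legendre_poly (Suc (Suc k)))) x"
  define l where "l = legendre k x"
  define m where "m = legendre (Suc k) x"
  define K where "K = real k"
  have K: "K \<ge> 0" by (simp add: K_def)
  have d: "(K + 2) * d = (2 * K + 3) * (m + x * b) - (K + 1) * a"
    using poly_pderiv_legendre_poly_recurrence[of k x] by (simp add: a_def b_def d_def m_def K_def)
  have n: "(K + 2) * legendre (Suc (Suc k)) x = (2 * K + 3) * x * m - (K + 1) * l"
    using legendre_recurrence[of k x] by (simp add: m_def l_def K_def)
  have 1: "b = x * a + (K + 1) * l" and 2: "x * b - a = (K + 1) * m"
    using Suc by (auto simp: a_def b_def l_def m_def K_def)
  have "(K + 2) * d = (K + 2) * (x * b + (K + 2) * m)"
    unfolding d using 2 by algebra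
  then have d': "d = x * b + (K + 2) * m" using K by simp
  have "x * d - b = (2 * K + 3) * x * m - (K + 1) * l"
    unfolding d' using 1 2 by algebra
  then show ?case
    using d' n[symmetric] by (simp add: b_def d_def m_def K_def algebra_simps)
qed

text \<open>Adding the first identity at \<open>Suc k\<close> to the second at \<open>k\<close>
  cancels the terms with a factor x. This yields an explicit antiderivative of
  \<open>legendre (Suc k)\<close>.\<close>

lemma legendre_eq_pderiv_diff:
  "(2 * real k + 3) * legendre (Suc k) x =
     poly (pderiv (legendre_poly (Suc (Suc k)))) x - poly (pderiv (legendre_poly k)) x"
  using conjunct2[OF pderiv_legendre_step[of k x]] conjunct1[OF pderiv_legendre_step[of "Suc k" x]]
  by (simp add: algebra_simps)

text \<open>The antiderivative vanishes at both endpoints, because the values of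
  \<open>legendre\<close> at 1 and -1 depend only on the parity of the index.\<close>

lemma integral_legendre_Suc: "integral {-1..1} (legendre (Suc k)) = 0"
proof -
  let ?f = "\<lambda>x. legendre (Suc (Suc k)) x - legendre k x"
  have deriv: "(?f has_real_derivative (2 * real k + 3) * legendre (Suc k) x) (at x)" for x
    unfolding legendre_eq_pderiv_diff by (intro DERIV_diff legendre_DERIV)
  have "((\<lambda>x. (2 * real k + 3) * legendre (Suc k) x) has_integral ?f 1 - ?f (-1)) {-1..1}"
    by (rule fundamental_theorem_of_calculus)
      (use deriv in \<open>auto simp flip: has_real_derivative_iff_has_vector_derivative
         intro: has_field_derivative_at_within\<close>)
  moreover have "?f 1 - ?f (-1) = 0"
    by (simp add: legendre_at_minus_1)
  ultimately have "integral {-1..1} (\<lambda>x. (2 * real k + 3) * legendre (Suc k) x) = 0"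
    by (metis integral_unique)
  then have "(2 * real k + 3) * integral {-1..1} (legendre (Suc k)) = 0"
    by (simp only: integral_mult_right)
  moreover have "2 * real k + 3 > 0" by simp
  ultimately show ?thesis by (metis mult_eq_0_iff less_irrefl)
qed

text \<open>The three-term recurrence trades one factor x for the neighbouring indices k + 1 and k -
  1, and both still exceed the lowered exponent.\<close>

lemma legendre_orthogonal_power:
  "j < k \<Longrightarrow> integral {-1..1} (\<lambda>x. x ^ j * legendre k x) = 0"
proof (induction j arbitrary: k)
  case 0
  then obtain m where "k = Suc m" by (cases k) auto
  then show ?case using integral_legendre_Suc[of m] by simp
next
  case (Suc j)
  then obtain m where k: "k = Suc m" by (cases k) auto
  have int: "(\<lambda>x. x ^ j * legendre i x) integrable_on {-1..1}" for i
    by (intro integrable_continuous_interval continuous_intros)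
  have "x ^ Suc j * legendre k x = ((real m + 2) / (2 * real m + 3)) * (x ^ j * legendre (Suc (Suc m)) x) +
      ((real m + 1) / (2 * real m + 3)) * (x ^ j * legendre m x)" for x
  proof -
    have "(2 * real m + 3) * (x ^ Suc j * legendre k x) = x ^ j * ((2 * real m + 3) * x * legendre (Suc m) x)"
      by (simp add: k)
    also have "(2 * real m + 3) * x * legendre (Suc m) x =
        (real m + 2) * legendre (Suc (Suc m)) x + (real m + 1) * legendre m x"
      using legendre_recurrence[of m x] by simp
    finally have "(2 * real m + 3) * (x ^ Suc j * legendre k x) =
        (real m + 2) * (x ^ j * legendre (Suc (Suc m)) x) + (real m + 1) * (x ^ j * legendre m x)"
      by (simp add: algebra_simps)
    then have "x ^ Suc j * legendre k x = ((real m + 2) * (x ^ j * legendre (Suc (Suc m)) x) +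
        (real m + 1) * (x ^ j * legendre m x)) / (2 * real m + 3)"
      by (simp add: nonzero_eq_divide_eq mult.commute del: power_Suc)
    then show ?thesis by (subst (asm) add_divide_distrib) simp
  qed
  then have "integral {-1..1} (\<lambda>x. x ^ Suc j * legendre k x) =
      ((real m + 2) / (2 * real m + 3)) * integral {-1..1} (\<lambda>x. x ^ j * legendre (Suc (Suc m)) x) +
      ((real m + 1) / (2 * real m + 3)) * integral {-1..1} (\<lambda>x. x ^ j * legendre m x)"
    by (simp only: integral_add integrable_on_mult_right int integral_mult_right)
  also have "\<dots> = 0"
    using Suc k by simp
  finally show ?case .
qed

lemma legendre_orthogonal:
  assumes "degree q < k"
  shows "integral {-1..1} (\<lambda>x. poly q x * legendre k x) = 0"
proof -
  have "integral {-1..1} (\<lambda>x. poly q x * legendre k x) =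
      integral {-1..1} (\<lambda>x. \<Sum>j\<le>degree q. coeff q j * (x ^ j * legendre k x))"
    by (simp add: poly_altdef sum_distrib_right mult.assoc)
  also have "\<dots> = (\<Sum>j\<le>degree q. integral {-1..1} (\<lambda>x. coeff q j * (x ^ j * legendre k x)))"
    by (intro integral_sum integrable_continuous_interval continuous_intros) auto
  also have "\<dots> = 0"
    using assms by (simp add: legendre_orthogonal_power)
  finally show ?thesis .
qed

section \<open>The reproducing kernel of the polynomials of degree at most N\<close>

lemma gamma00_nonzero: "gamma00 k \<noteq> 0"
  by (simp add: gamma00_def)

text \<open>The weights 1 / \<open>gamma00 k\<close> = (2k + 1) / 2 are exactly those for which the
  recurrence makes the sum telescope. Keeping x - y as a factor makes the identity meaningful for x
  = y as well.\<close>

lemma christoffel_darboux: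
  "(x - y) * (\<Sum>k\<le>N. legendre k x * legendre k y / gamma00 k) =
     (real N + 1) / 2 * (legendre (Suc N) x * legendre N y - legendre N x * legendre (Suc N) y)"
proof (induction N)
  case 0
  then show ?case by (simp add: gamma00_def)
next
  case (Suc N)
  have "(x - y) * (\<Sum>k\<le>Suc N. legendre k x * legendre k y / gamma00 k) =
     (real N + 1) / 2 * (legendre (Suc N) x * legendre N y - legendre N x * legendre (Suc N) y)
      + (x - y) * (2 * real N + 3) / 2 * (legendre (Suc N) x * legendre (Suc N) y)"
    using Suc by (simp add: gamma00_def field_simps)
  also have "\<dots> = (real (Suc N) + 1) / 2 *
      (legendre (Suc (Suc N)) x * legendre (Suc N) y - legendre (Suc N) x * legendre (Suc (Suc N)) y)"
    using legendre_recurrence[of N x] legendre_recurrence[of N y] unfolding of_nat_Suc by algebra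
  finally show ?case .
qed

text \<open>Split u(x) = u(y) + (x - y) q(x). Against the constant u(y) only the term k = 0 of the
  kernel survives and gives u(y). By Christoffel-Darboux, the factor x - y turns the rest into
  multiples of q times the Legendre polynomials of index N + 1 and N, both orthogonal to q.\<close>

lemma legendre_kernel_reproducing:
  assumes "degree u \<le> N"
  shows "integral {-1..1} (\<lambda>x. (\<Sum>k\<le>N. legendre k x * legendre k y / gamma00 k) * poly u x) = poly u y"
proof -
  let ?K = "\<lambda>x. \<Sum>k\<le>N. legendre k x * legendre k y / gamma00 k"
  define q where "q = synthetic_div u y"
  have u: "poly u x = poly u y + (x - y) * poly q x" for x
  proof -
    have "poly u x = poly ([:- y, 1:] * q + [:poly u y:]) x"
      by (simp only: q_def synthetic_div_correct')
    then show ?thesis by (simp add: algebra_simps)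
  qed
  have "integral {-1..1} ?K = (\<Sum>k\<le>N. legendre k y / gamma00 k * integral {-1..1} (legendre k))"
  proof -
    have "integral {-1..1} ?K = (\<Sum>k\<le>N. integral {-1..1} (\<lambda>x. legendre k y / gamma00 k * legendre k x))"
      by (subst integral_sum[symmetric])
        (auto intro!: integrable_continuous_interval continuous_intros simp: mult.commute gamma00_nonzero)
    then show ?thesis by (simp only: integral_mult_right)
  qed
  also have "\<dots> = (\<Sum>k\<le>N. if k = 0 then 1 else 0)"
  proof (rule sum.cong[OF refl])
    fix k
    show "legendre k y / gamma00 k * integral {-1..1} (legendre k) = (if k = 0 then 1 else 0)"
      by (cases k) (simp_all add: integral_legendre_Suc gamma00_def legendre.simps(1)[abs_def])
  qed
  finally have K: "integral {-1..1} ?K = 1" by simp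
  have q: "integral {-1..1} (\<lambda>x. poly q x * legendre (Suc N) x) = 0"
    "N > 0 \<Longrightarrow> integral {-1..1} (\<lambda>x. poly q x * legendre N x) = 0"
    using assms by (auto intro!: legendre_orthogonal simp: q_def degree_synthetic_div)
  \<comment> \<open>For N = 0 the degree of q is not strictly below N, but q itself is then
    zero.\<close>
  have q0: "integral {-1..1} (\<lambda>x. poly q x * legendre N x) = 0"
  proof (cases "N = 0")
    case True
    with assms have "q = 0" by (simp add: q_def synthetic_div_eq_0_iff)
    then show ?thesis by simp
  qed (use q in simp)
  have eq: "?K x * poly u x = poly u y * ?K x +
      ((real N + 1) / 2 * legendre N y * (poly q x * legendre (Suc N) x)
      - (real N + 1) / 2 * legendre (Suc N) y * (poly q x * legendre N x))" for x
  proof -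
    define K where "K = ?K x"
    have "(x - y) * K = (real N + 1) / 2 * (legendre (Suc N) x * legendre N y - legendre N x * legendre (Suc N) y)"
      unfolding K_def by (rule christoffel_darboux)
    then show ?thesis
      unfolding K_def[symmetric] u[of x] by algebra
  qed
  have "(?K has_integral 1) {-1..1}"
    by (subst has_integral_integrable_integral, intro conjI K integrable_continuous_interval continuous_intros)
      (simp add: gamma00_nonzero)
  moreover have "((\<lambda>x. poly q x * legendre (Suc N) x) has_integral 0) {-1..1}"
    by (subst has_integral_integrable_integral, intro conjI q(1) integrable_continuous_interval continuous_intros)
  moreover have "((\<lambda>x. poly q x * legendre N x) has_integral 0) {-1..1}"
    by (subst has_integral_integrable_integral, intro conjI q0 integrable_continuous_interval continuous_intros)
  ultimately have "((\<lambda>x. poly u y * ?K x +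
      ((real N + 1) / 2 * legendre N y * (poly q x * legendre (Suc N) x)
      - (real N + 1) / 2 * legendre (Suc N) y * (poly q x * legendre N x))) has_integral poly u y * 1 +
      ((real N + 1) / 2 * legendre N y * 0 - (real N + 1) / 2 * legendre (Suc N) y * 0)) {-1..1}"
    by (intro has_integral_add has_integral_diff has_integral_mult_right)
  then show ?thesis
    unfolding eq[symmetric] by (simp add: integral_unique)
qed

section \<open>Fractional integrals of polynomials\<close>

lemma integrable_on_abel_kernel_monomial:
  assumes "s > 0"
  shows "(\<lambda>t::real. (1 - t) powr (s - 1) * t ^ k) integrable_on {0..1}"
proof -
  have "(\<lambda>t::real. t powr (real (Suc k) - 1) * (1 - t) powr (s - 1)) integrable_on {0..1}"
    by (rule set_borel_integral_eq_integral(1)[OF integrable_Beta]) (use assms in auto)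
  \<comment> \<open>At t = 0 and k = 0 the two integrands differ: \<open>0 powr 0\<close> is 0 while
    \<open>0 ^ 0\<close> is 1.\<close>
  then show ?thesis
    by (rule integrable_spike[where S = "{0}"]) (auto simp: powr_realpow mult.commute)
qed

text \<open>The substitution t = (y + 1) / (x + 1) maps [-1, x] to [0, 1] and leaves a Beta integral
  free of x. At x = -1 both sides are 0.\<close>

lemma has_integral_abel_monomial:
  assumes "s > 0" "x \<ge> -1"
  shows "((\<lambda>y. (x - y) powr (s - 1) * (y + 1) ^ k) has_integral
           (x + 1) powr (s + real k) * integral {0..1} (\<lambda>t. (1 - t) powr (s - 1) * t ^ k)) {-1..x}"
proof (cases "x = -1")
  case False
  with assms have x: "x + 1 > 0" by simp
  let ?f = "\<lambda>t::real. (1 - t) powr (s - 1) * t ^ k"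
  define m where "m = 1 / (x + 1)"
  have m: "m > 0" using x by (simp add: m_def)
  have "((\<lambda>y. ?f (m *\<^sub>R y + m)) has_integral integral {0..1} ?f /\<^sub>R m ^ DIM(real))
      (cbox ((0 - m) /\<^sub>R m) ((1 - m) /\<^sub>R m))"
    by (rule has_integral_affinity')
      (use integrable_on_abel_kernel_monomial[OF \<open>s > 0\<close>, of k] m in \<open>auto simp: integrable_integral\<close>)
  moreover have "(0 - m) /\<^sub>R m = -1" "(1 - m) /\<^sub>R m = x"
    using x by (auto simp: m_def field_simps)
  ultimately have "((\<lambda>y. (x + 1) powr (s - 1 + real k) * ?f (m * y + m)) has_integral
      (x + 1) powr (s - 1 + real k) * (integral {0..1} ?f * (x + 1))) {-1..x}"
    by (intro has_integral_mult_right) (simp add: m_def mult.commute)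
  moreover have "(x + 1) powr (s - 1 + real k) * (integral {0..1} ?f * (x + 1)) =
      (x + 1) powr (s + real k) * integral {0..1} ?f"
    using x powr_add[of "x + 1" "s - 1 + real k" 1] by (simp add: algebra_simps)
  moreover have "(x + 1) powr (s - 1 + real k) * ?f (m * y + m) = (x - y) powr (s - 1) * (y + 1) ^ k"
    if "y \<in> {-1..x}" for y
  proof -
    have "1 - (m * y + m) = (x - y) / (x + 1)" "m * y + m = (y + 1) / (x + 1)"
      using x by (auto simp: m_def field_simps)
    then show ?thesis
      using x that by (simp add: powr_add powr_realpow powr_divide power_divide)
  qed
  ultimately show ?thesis
    by (metis (no_types, lifting) has_integral_eq)
qed auto

lemma has_integral_abel_poly:
  fixes w :: "real poly"
  assumes "s > 0" "x \<ge> -1"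
  defines "q \<equiv> pcompose w [:-1, 1:]"
  shows "((\<lambda>y. (x - y) powr (s - 1) * poly w y) has_integral
           (\<Sum>k\<le>degree q. coeff q k * ((x + 1) powr (s + real k) *
              integral {0..1} (\<lambda>t. (1 - t) powr (s - 1) * t ^ k)))) {-1..x}"
proof -
  have "poly w y = (\<Sum>k\<le>degree q. coeff q k * (y + 1) ^ k)" for y
    unfolding poly_altdef[of q "y + 1", symmetric] by (simp add: q_def poly_pcompose)
  then have "(x - y) powr (s - 1) * poly w y =
      (\<Sum>k\<le>degree q. coeff q k * ((x - y) powr (s - 1) * (y + 1) ^ k))" for y
    by (simp add: sum_distrib_left mult.left_commute)
  then show ?thesis
    by (simp only:)
      (intro has_integral_sum has_integral_mult_right has_integral_abel_monomial assms finite_atMost)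
qed

text \<open>Expanding \<open>w\<close> about -1 gives a finite sum of powers of x + 1 with
  coefficients independent of x. The exponents are positive, hence continuity up to -1, while
  differentiability is available only to the right of -1.\<close>

lemma leftI_poly_eq:
  assumes "s > 0"
  obtains n :: nat and b :: "nat \<Rightarrow> real"
  where "\<And>x. x \<ge> -1 \<Longrightarrow> leftI s (poly w) x = (\<Sum>k\<le>n. b k * (x + 1) powr (s + real k))"
proof
  let ?q = "pcompose w [:-1, 1:]"
  fix x :: real
  assume "x \<ge> -1"
  from integral_unique[OF has_integral_abel_poly[OF assms this, of w]]
  show "leftI s (poly w) x = (\<Sum>k\<le>degree ?q. (coeff ?q k *
      integral {0..1} (\<lambda>t. (1 - t) powr (s - 1) * t ^ k) / Gamma s) * (x + 1) powr (s + real k))"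
    by (simp add: leftI_def sum_divide_distrib mult_ac)
qed

lemma continuous_on_leftI_poly:
  assumes "s > 0"
  shows "continuous_on {-1..1} (leftI s (poly w))"
proof -
  obtain n b where
    "\<And>x. x \<ge> -1 \<Longrightarrow> leftI s (poly w) x = (\<Sum>k\<le>n. b k * (x + 1) powr (s + real k))"
    using leftI_poly_eq[OF assms] by blast
  moreover have "continuous_on {-1..1} (\<lambda>x::real. \<Sum>k\<le>n. b k * (x + 1) powr (s + real k))"
    using assms by (intro continuous_intros continuous_on_powr') auto
  ultimately show ?thesis
    by (subst continuous_on_cong[OF refl]) auto
qed

lemma field_differentiable_leftI_poly:
  assumes "s > 0" "x > -1"
  shows "leftI s (poly w) field_differentiable at x"
proof -
  obtain n b where eq:
    "\<And>x. x \<ge> -1 \<Longrightarrow> leftI s (poly w) x = (\<Sum>k\<le>n. b k * (x + 1) powr (s + real k))"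
    using leftI_poly_eq[OF assms(1)] by blast
  have "((\<lambda>x. \<Sum>k\<le>n. b k * (x + 1) powr (s + real k)) has_real_derivative
      (\<Sum>k\<le>n. b k * ((s + real k) * (x + 1) powr (s + real k - 1)))) (at x)"
    using assms by (auto intro!: derivative_eq_intros simp: mult_ac)
  then have "(leftI s (poly w) has_real_derivative
      (\<Sum>k\<le>n. b k * ((s + real k) * (x + 1) powr (s + real k - 1)))) (at x)"
    by (rule has_field_derivative_transform_within_open[where S = "{-1<..}"])
      (use assms eq in auto)
  then show ?thesis by (auto simp: field_differentiable_def)
qed

text \<open>The reflection y to -y transfers the regularity of left fractional integrals to right
  ones.\<close>

lemma rightI_poly_eq_leftI:
  "rightI s (poly w) x = leftI s (poly (pcompose w [:0, -1:])) (- x)"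
  using Henstock_Kurzweil_Integration.integral_reflect_real[of 1 x "\<lambda>y. (y - x) powr (s - 1) * poly w y"]
  by (simp add: rightI_def leftI_def poly_pcompose minus_diff_commute[of x])

lemma continuous_on_rightI_poly:
  assumes "s > 0"
  shows "continuous_on {-1..1} (rightI s (poly w))"
  unfolding rightI_poly_eq_leftI[abs_def]
  by (rule continuous_on_compose2[OF continuous_on_leftI_poly[OF assms]]) (auto intro!: continuous_intros)

lemma field_differentiable_rightI_poly:
  assumes "s > 0" "x < 1"
  shows "rightI s (poly w) field_differentiable at x"
proof -
  have "(leftI s (poly (pcompose w [:0, -1:])) \<circ> uminus) field_differentiable at x"
    using assms by (intro field_differentiable_compose field_differentiable_leftI_poly field_differentiable_minus
       field_differentiable_ident[unfolded id_def]) auto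
  then show ?thesis by (simp add: rightI_poly_eq_leftI[abs_def] o_def)
qed

text \<open>Integration by parts with \<open>D\<close> differentiable only in the interior:
  fractional integrals contain terms like (x + 1) powr s with s < 1, whose derivative blows up at
  the endpoint. Integrability of \<open>deriv D x * u x\<close> is itself obtained from the interior
  fundamental theorem.\<close>

lemma integral_deriv_mult:
  fixes D u u' :: "real \<Rightarrow> real"
  assumes "a \<le> b" and D: "continuous_on {a..b} D" "\<And>x. x \<in> {a<..<b} \<Longrightarrow> D field_differentiable at x"
    and u: "\<And>x. (u has_real_derivative u' x) (at x)" "continuous_on {a..b} u'"
  shows "integral {a..b} (\<lambda>x. deriv D x * u x) = D b * u b - D a * u a - integral {a..b} (\<lambda>x. D x * u' x)"
proof -
  have cu: "continuous_on {a..b} u"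
    using DERIV_continuous_on[OF DERIV_subset[OF u(1)]] by blast
  have "((\<lambda>x. deriv D x * u x + D x * u' x) has_integral D b * u b - D a * u a) {a..b}"
  proof (rule fundamental_theorem_of_calculus_interior[OF \<open>a \<le> b\<close>])
    show "continuous_on {a..b} (\<lambda>x. D x * u x)"
      by (intro continuous_intros D cu)
    fix x assume "x \<in> {a<..<b}"
    then have "(D has_real_derivative deriv D x) (at x)"
      by (simp add: D(2) DERIV_deriv_iff_field_differentiable)
    then show "((\<lambda>x. D x * u x) has_vector_derivative deriv D x * u x + D x * u' x) (at x)"
      unfolding has_real_derivative_iff_has_vector_derivative[symmetric]
      using u(1)[of x] by (auto intro!: derivative_eq_intros)
  qed
  moreover have "((\<lambda>x. D x * u' x) has_integral integral {a..b} (\<lambda>x. D x * u' x)) {a..b}"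
    by (intro integrable_integral integrable_continuous_interval continuous_intros D u)
  ultimately have "((\<lambda>x. (deriv D x * u x + D x * u' x) - D x * u' x) has_integral
      (D b * u b - D a * u a) - integral {a..b} (\<lambda>x. D x * u' x)) {a..b}"
    by (rule has_integral_diff)
  then show ?thesis by (simp add: integral_unique)
qed

lemma deriv_poly [simp]: "deriv (poly u) = poly (pderiv (u :: real poly))"
  by (rule ext) (rule DERIV_imp_deriv[OF poly_DERIV])

section \<open>Positivity of the Riesz energy\<close>

lemma has_bochner_integral_std_normal_cos:
  "has_bochner_integral lborel (\<lambda>x. std_normal_density x * cos (u * x)) (exp (- u\<^sup>2 / 2))"
proof -
  have int: "integrable lborel (\<lambda>x. std_normal_density x *\<^sub>R iexp (u * x))"
    by (rule Bochner_Integration.integrable_bound[OF integrable_normal_density[where \<mu> = 0 and \<sigma> = 1]]) auto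
  \<comment> \<open>The formula is the real part of the characteristic function of the standard
    normal distribution.\<close>
  have "complex_of_real (exp (- u\<^sup>2 / 2)) = char std_normal_distribution u"
    by (simp add: char_std_normal_distribution)
  also have "\<dots> = (\<integral>x. std_normal_density x *\<^sub>R iexp (u * x) \<partial>lborel)"
    by (simp add: char_def integral_density)
  finally have "has_bochner_integral lborel (\<lambda>x. std_normal_density x *\<^sub>R iexp (u * x)) (complex_of_real (exp (- u\<^sup>2 / 2)))"
    using int by (simp add: has_bochner_integral_iff)
  from has_bochner_integral_bounded_linear[OF bounded_linear_Re this]
  show ?thesis by (simp add: Re_exp)
qed

text \<open>Rescaling by \<open>sqrt (2 * t)\<close> turns the standard normal formula into one for
  variance 2t.\<close>

lemma has_bochner_integral_normal_cos:
  assumes "t > 0"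
  shows "has_bochner_integral lborel (\<lambda>\<xi>. normal_density 0 (sqrt (2 * t)) \<xi> * cos (\<xi> * z)) (exp (- t * z\<^sup>2))"
proof -
  let ?c = "sqrt (2 * t)"
  have c: "?c > 0" using assms by simp
  have "normal_density 0 ?c (0 + ?c * x) = std_normal_density x / ?c" for x
    using assms by (simp add: normal_density_def power_mult_distrib real_sqrt_mult field_simps)
  then have "(\<lambda>x. normal_density 0 ?c (0 + ?c * x) * cos ((0 + ?c * x) * z)) =
      (\<lambda>x. (1 / ?c) * (std_normal_density x * cos ((?c * z) * x)))"
    by (simp add: fun_eq_iff mult_ac)
  moreover have "has_bochner_integral lborel (\<lambda>x. (1 / ?c) * (std_normal_density x * cos ((?c * z) * x)))
      ((1 / ?c) * exp (- (?c * z)\<^sup>2 / 2))"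
    by (intro has_bochner_integral_mult_right has_bochner_integral_std_normal_cos)
  moreover have "(1 / ?c) * exp (- (?c * z)\<^sup>2 / 2) = exp (- t * z\<^sup>2) /\<^sub>R \<bar>?c\<bar>"
  proof -
    have e: "- (?c * z)\<^sup>2 / 2 = - t * z\<^sup>2"
      using assms by (simp add: power_mult_distrib)
    have "1 / C * E = E /\<^sub>R \<bar>C\<bar>" if "C > 0" for C E :: real
      using that by (simp add: divide_inverse)
    from this[OF c] show ?thesis unfolding e .
  qed
  ultimately show ?thesis
    using c by (subst lborel_has_bochner_integral_real_affine_iff[where c = ?c and t = 0]) simp_all
qed

text \<open>Euler's integral after the substitution t to b t. With b = (x - y)^2 it will write a
  power of |x - y| as a mixture of Gaussians.\<close>

lemma has_bochner_integral_Gamma_scaled: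
  fixes a b :: real
  assumes "a > 0" "b > 0"
  shows "has_bochner_integral lborel (\<lambda>t. indicator {0<..} t * t powr (a - 1) * exp (- t * b)) (Gamma a * b powr - a)"
proof -
  have "(\<integral>\<^sup>+t. ennreal (indicator {0..} t * t powr (a - 1) / exp t) \<partial>lborel) = ennreal (Gamma a)"
    using Gamma_conv_nn_integral_real[OF \<open>a > 0\<close>] by simp
  also have "(\<integral>\<^sup>+t. ennreal (indicator {0..} t * t powr (a - 1) / exp t) \<partial>lborel) =
      (\<integral>\<^sup>+t. ennreal (indicator {0<..} t * t powr (a - 1) * exp (- t)) \<partial>lborel)"
    by (intro nn_integral_cong_AE AE_I[where N = "{0}"]) (auto simp: indicator_def exp_minus divide_inverse)
  finally have "has_bochner_integral lborel (\<lambda>t. indicator {0<..} t * t powr (a - 1) * exp (- t)) (Gamma a)"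
    using assms by (intro has_bochner_integral_nn_integral) (auto intro: Gamma_real_nonneg less_imp_le)
  then have "has_bochner_integral lborel
      (\<lambda>t. b powr (1 - a) * (indicator {0<..} (0 + b * t) * (0 + b * t) powr (a - 1) * exp (- (0 + b * t))))
      (b powr (1 - a) * (Gamma a /\<^sub>R \<bar>b\<bar>))"
    using assms
    by (intro has_bochner_integral_mult_right)
      (subst (asm) lborel_has_bochner_integral_real_affine_iff[where c = b and t = 0], auto)
  moreover have "b powr (1 - a) * (indicator {0<..} (0 + b * t) * (0 + b * t) powr (a - 1) * exp (- (0 + b * t)))
      = indicator {0<..} t * t powr (a - 1) * exp (- t * b)" for t
  proof -
    have "b powr (1 - a) * b powr (a - 1) = 1"
      using assms by (simp flip: powr_add)
    then have "b powr (1 - a) * (b powr (a - 1) * r) = r" for r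
      by (metis mult.assoc mult_1)
    then show ?thesis
      using assms by (auto simp: indicator_def zero_less_mult_iff powr_mult mult.commute[of t b])
  qed
  moreover have "b powr (1 - a) * (Gamma a /\<^sub>R \<bar>b\<bar>) = Gamma a * b powr - a"
    using assms by (simp add: powr_diff powr_minus field_simps)
  ultimately show ?thesis by (simp only:)
qed

section \<open>Integrability of the Riesz kernel against bounded functions on [-1, 1]\<close>

lemma integrable_riesz_kernel:
  assumes "s > 0"
  shows "integrable lborel (\<lambda>z::real. indicator {-2..2} z * \<bar>z\<bar> powr (s - 1))"
proof -
  let ?f = "\<lambda>z::real. indicator {0..2} z * z powr (s - 1)"
  have "(\<lambda>z::real. z powr (s - 1)) absolutely_integrable_on {0..2}"
    using integrable_on_powr_from_0[of "s - 1" 2] assms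
    by (subst absolutely_integrable_on_iff_nonneg) auto
  then have f: "integrable lborel ?f"
    by (subst (asm) set_integrable_def, subst (asm) integrable_completion) auto
  then have "integrable lborel (\<lambda>z. ?f (0 + (-1) * z))"
    by (subst lborel_integrable_real_affine_iff) auto
  from Bochner_Integration.integrable_add[OF f this]
  show ?thesis
    by (rule Bochner_Integration.integrable_cong_AE_imp) (auto intro!: AE_I2 simp: indicator_def)
qed

text \<open>The function \<open>g\<close> stands for u' extended by zero, so that integrals over
  [-1, 1] become integrals over the line, where Fourier and Fubini arguments apply.\<close>

locale cutoff_function =
  fixes g :: "real \<Rightarrow> real" and M :: real
  assumes g_measurable [measurable]: "g \<in> borel_measurable borel"
    and g_bound: "\<bar>g x\<bar> \<le> M * indicator {-1..1} x"
begin

lemma M_nonneg: "M \<ge> 0"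
  using g_bound[of 0] by simp

lemma integrable_g: "integrable lborel g"
proof (rule Bochner_Integration.integrable_bound)
  show "integrable lborel (\<lambda>x::real. M * indicator {-1..1} x)"
    by (intro Bochner_Integration.integrable_mult_right integrable_real_indicator) auto
  show "AE x in lborel. norm (g x) \<le> norm (M * indicator {-1..1} x)"
    using g_bound M_nonneg by (intro AE_I2) simp
qed simp

lemma integrable_g_mult:
  assumes [measurable]: "h \<in> borel_measurable borel" and h: "\<And>x. \<bar>h x\<bar> \<le> 1"
  shows "integrable lborel (\<lambda>x. g x * h x :: real)"
  by (rule Bochner_Integration.integrable_bound[OF integrable_g])
    (use h in \<open>auto intro!: AE_I2 mult_left_le simp: abs_mult\<close>)

text \<open>Two points of [-1, 1] differ by at most 2. Apart from the indicator of x, the majorant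
  depends on x - y alone, written \<open>x + (-1) * y\<close> to match affine substitution.\<close>

lemma riesz_bound:
  "norm (\<bar>x - y\<bar> powr (s - 1) * (g x * g y)) \<le>
     M\<^sup>2 * indicator {-1..1} x * (indicator {-2..2} (x + (-1) * y) * \<bar>x + (-1) * y\<bar> powr (s - 1))"
proof -
  have "\<bar>g x\<bar> * \<bar>g y\<bar> \<le> (M * indicator {-1..1} x) * (M * indicator {-1..1} y)"
    by (intro mult_mono g_bound) (auto simp: M_nonneg)
  also have "\<dots> \<le> M\<^sup>2 * indicator {-1..1} x * indicator {-2..2} (x - y)"
    by (auto simp: indicator_def power2_eq_square)
  finally have "\<bar>g x\<bar> * \<bar>g y\<bar> * \<bar>x - y\<bar> powr (s - 1) \<le>
      M\<^sup>2 * indicator {-1..1} x * indicator {-2..2} (x - y) * \<bar>x - y\<bar> powr (s - 1)"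
    by (rule mult_right_mono) simp
  then show ?thesis by (simp add: abs_mult mult_ac)
qed

lemma integrable_riesz_kernel_shift:
  assumes "s > 0"
  shows "integrable lborel (\<lambda>y. c * (indicator {-2..2} (x + (-1) * y) * \<bar>x + (-1) * y\<bar> powr (s - 1)) :: real)"
  using integrable_riesz_kernel[OF assms]
  by (intro Bochner_Integration.integrable_mult_right)
    (subst (asm) lborel_integrable_real_affine_iff[of "-1" _ x, symmetric], auto)

lemma integrable_riesz_section:
  assumes "s > 0"
  shows "integrable lborel (\<lambda>y. \<bar>x - y\<bar> powr (s - 1) * (g x * g y))"
proof (rule Bochner_Integration.integrable_bound[OF integrable_riesz_kernel_shift[OF assms,
      of "M\<^sup>2 * indicator {-1..1} x" x]])
  show "AE y in lborel. norm (\<bar>x - y\<bar> powr (s - 1) * (g x * g y)) \<le>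
      norm (M\<^sup>2 * indicator {-1..1} x * (indicator {-2..2} (x + (-1) * y) * \<bar>x + (-1) * y\<bar> powr (s - 1)))"
    by (intro AE_I2 order_trans[OF riesz_bound]) simp
qed simp

text \<open>By translation and reflection invariance the majorant has the same y-integral
  \<open>K\<close>, up to the factor in front, for every x in [-1, 1].\<close>

lemma integrable_riesz:
  assumes "s > 0"
  shows "integrable (lborel \<Otimes>\<^sub>M lborel) (\<lambda>(x, y). \<bar>x - y\<bar> powr (s - 1) * (g x * g y))"
proof (rule lborel_pair.Fubini_integrable)
  let ?k = "\<lambda>z::real. indicator {-2..2} z * \<bar>z\<bar> powr (s - 1)"
  define K where "K = (\<integral>z. ?k z \<partial>lborel)"
  show "integrable lborel (\<lambda>x. \<integral>y. norm (case (x, y) of (x, y) \<Rightarrow> \<bar>x - y\<bar> powr (s - 1) * (g x * g y)) \<partial>lborel)"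
  proof (rule Bochner_Integration.integrable_bound)
    show "integrable lborel (\<lambda>x::real. M\<^sup>2 * K * indicator {-1..1} x)"
      by (intro Bochner_Integration.integrable_mult_right integrable_real_indicator) auto
    show "AE x in lborel. norm (\<integral>y. norm (case (x, y) of (x, y) \<Rightarrow> \<bar>x - y\<bar> powr (s - 1) * (g x * g y)) \<partial>lborel)
       \<le> norm (M\<^sup>2 * K * indicator {-1..1} x)"
    proof (rule AE_I2)
      fix x :: real
      have "K = (\<integral>y. ?k (x + (-1) * y) \<partial>lborel)"
        unfolding K_def by (subst lborel_integral_real_affine[where c = "-1" and t = x]) auto
      then have K: "M\<^sup>2 * indicator {-1..1} x * K = (\<integral>y. M\<^sup>2 * indicator {-1..1} x * ?k (x + (-1) * y) \<partial>lborel)"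
        by simp
      have "(\<integral>y. norm (\<bar>x - y\<bar> powr (s - 1) * (g x * g y)) \<partial>lborel) \<le> M\<^sup>2 * indicator {-1..1} x * K"
        unfolding K
        by (intro integral_mono integrable_norm integrable_riesz_section
            integrable_riesz_kernel_shift assms riesz_bound)
      then show "norm (\<integral>y. norm (case (x, y) of (x, y) \<Rightarrow> \<bar>x - y\<bar> powr (s - 1) * (g x * g y)) \<partial>lborel)
         \<le> norm (M\<^sup>2 * K * indicator {-1..1} x)"
        by (simp add: mult_ac order_trans[OF _ abs_ge_self])
    qed
  qed simp
  show "AE x in lborel. integrable lborel (\<lambda>y. case (x, y) of (x, y) \<Rightarrow> \<bar>x - y\<bar> powr (s - 1) * (g x * g y))"
    using integrable_riesz_section[OF assms] by simp
qed simp

end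

lemma (in pair_sigma_finite) integrable_mult_pair:
  fixes f :: "'a \<Rightarrow> real" and h :: "'b \<Rightarrow> real"
  assumes f: "integrable M1 f" and h: "integrable M2 h"
  shows "integrable (M1 \<Otimes>\<^sub>M M2) (\<lambda>z. f (fst z) * h (snd z))"
proof (rule Fubini_integrable)
  have [measurable]: "f \<in> borel_measurable M1" "h \<in> borel_measurable M2"
    using f h by auto
  show "(\<lambda>z. f (fst z) * h (snd z)) \<in> borel_measurable (M1 \<Otimes>\<^sub>M M2)"
    by measurable
  show "integrable M1 (\<lambda>x. \<integral>y. norm (f (fst (x, y)) * h (snd (x, y))) \<partial>M2)"
    using f by (simp add: abs_mult)
  show "AE x in M1. integrable M2 (\<lambda>y. f (fst (x, y)) * h (snd (x, y)))"
    using h by simp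
qed

lemma (in pair_sigma_finite) integral_mult_pair:
  fixes f :: "'a \<Rightarrow> real" and h :: "'b \<Rightarrow> real"
  assumes f: "integrable M1 f" and h: "integrable M2 h"
  shows "(\<integral>z. f (fst z) * h (snd z) \<partial>(M1 \<Otimes>\<^sub>M M2)) = (\<integral>x. f x \<partial>M1) * (\<integral>y. h y \<partial>M2)"
  using integral_fst'[OF integrable_mult_pair[OF assms]] by simp

lemma pair_sigma_finite_lborel_3:
  "pair_sigma_finite (lborel :: real measure) (lborel \<Otimes>\<^sub>M lborel :: (real \<times> real) measure)"
  "pair_sigma_finite (lborel \<Otimes>\<^sub>M lborel :: (real \<times> real) measure) (lborel :: real measure)"
  by (simp_all add: pair_sigma_finite_def lborel_prod sigma_finite_lborel)

section \<open>The Riesz energy as a mixture of Gaussian energies\<close>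

context cutoff_function
begin

definition riesz_energy :: "real \<Rightarrow> real" where
  "riesz_energy s = (\<integral>z. \<bar>fst z - snd z\<bar> powr (s - 1) * (g (fst z) * g (snd z)) \<partial>(lborel \<Otimes>\<^sub>M lborel))"

text \<open>The squared modulus of the Fourier transform of \<open>g\<close>, without the factor 1 /
  (2 pi), kept real by separating cosine and sine parts.\<close>

definition power_spectrum :: "real \<Rightarrow> real" where
  "power_spectrum \<xi> = (\<integral>x. g x * cos (\<xi> * x) \<partial>lborel)\<^sup>2 + (\<integral>x. g x * sin (\<xi> * x) \<partial>lborel)\<^sup>2"

lemma power_spectrum_nonneg: "power_spectrum \<xi> \<ge> 0"
  by (simp add: power_spectrum_def)

lemma measurable_power_spectrum [measurable]: "power_spectrum \<in> borel_measurable borel"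
  unfolding power_spectrum_def[abs_def] by measurable

lemma integrable_riesz_fst_snd: 
  "s > 0 \<Longrightarrow> integrable (lborel \<Otimes>\<^sub>M lborel) (\<lambda>z. \<bar>fst z - snd z\<bar> powr (s - 1) * (g (fst z) * g (snd z)))"
  using integrable_riesz by (simp add: case_prod_beta')

text \<open>The Riesz kernel takes the junk value 0 on the diagonal, so the two open triangles carry all of the energy.\<close>

lemma riesz_triangle:
  assumes "s > 0"
  shows "integrable lborel (\<lambda>x. \<integral>y. (if y < x then \<bar>x - y\<bar> powr (s - 1) * (g x * g y) else 0) \<partial>lborel)"
    "(\<integral>x. (\<integral>y. (if y < x then \<bar>x - y\<bar> powr (s - 1) * (g x * g y) else 0) \<partial>lborel) \<partial>lborel) = riesz_energy s / 2"
    "integrable lborel (\<lambda>x. \<integral>y. (if x < y then \<bar>x - y\<bar> powr (s - 1) * (g x * g y) else 0) \<partial>lborel)"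
    "(\<integral>x. (\<integral>y. (if x < y then \<bar>x - y\<bar> powr (s - 1) * (g x * g y) else 0) \<partial>lborel) \<partial>lborel) = riesz_energy s / 2"
proof -
  define h where "h = (\<lambda>z. \<bar>fst z - snd z\<bar> powr (s - 1) * (g (fst z) * g (snd z)))"
  define l where "l = (\<lambda>z. if snd z < fst z then h z else 0)"
  define r where "r = (\<lambda>z. if fst z < snd z then h z else 0)"
  have [measurable]: "h \<in> borel_measurable (lborel \<Otimes>\<^sub>M lborel)" "l \<in> borel_measurable (lborel \<Otimes>\<^sub>M lborel)"
    "r \<in> borel_measurable (lborel \<Otimes>\<^sub>M lborel)"
    unfolding l_def r_def h_def by measurable
  have h: "integrable (lborel \<Otimes>\<^sub>M lborel) h"
    unfolding h_def by (rule integrable_riesz_fst_snd[OF assms])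
  have l: "integrable (lborel \<Otimes>\<^sub>M lborel) l"
    by (rule Bochner_Integration.integrable_bound[OF h]) (auto simp: l_def)
  have r: "integrable (lborel \<Otimes>\<^sub>M lborel) r"
    by (rule Bochner_Integration.integrable_bound[OF h]) (auto simp: r_def)
  have "h = (\<lambda>z. l z + r z)"
    by (auto simp: l_def r_def h_def fun_eq_iff)
  then have "integral\<^sup>L (lborel \<Otimes>\<^sub>M lborel) h = integral\<^sup>L (lborel \<Otimes>\<^sub>M lborel) l + integral\<^sup>L (lborel \<Otimes>\<^sub>M lborel) r"
    using l r by simp
  \<comment> \<open>Swapping the variables exchanges the triangles and preserves the symmetric
    integrand \<open>h\<close>.\<close>
  moreover have "integral\<^sup>L (lborel \<Otimes>\<^sub>M lborel) l = integral\<^sup>L (lborel \<Otimes>\<^sub>M lborel) r"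
    by (subst lborel_pair.integral_product_swap[symmetric])
      (auto simp: l_def r_def h_def case_prod_beta' mult_ac abs_minus_commute intro!: Bochner_Integration.integral_cong)
  moreover have "integral\<^sup>L (lborel \<Otimes>\<^sub>M lborel) h = riesz_energy s"
    by (simp add: riesz_energy_def h_def)
  ultimately have "integral\<^sup>L (lborel \<Otimes>\<^sub>M lborel) l = riesz_energy s / 2" "integral\<^sup>L (lborel \<Otimes>\<^sub>M lborel) r = riesz_energy s / 2"
    by auto
  moreover have "(if y < x then \<bar>x - y\<bar> powr (s - 1) * (g x * g y) else 0) = l (x, y)"
    "(if x < y then \<bar>x - y\<bar> powr (s - 1) * (g x * g y) else 0) = r (x, y)" for x y
    by (simp_all add: l_def r_def h_def)
  ultimately show "integrable lborel (\<lambda>x. \<integral>y. (if y < x then \<bar>x - y\<bar> powr (s - 1) * (g x * g y) else 0) \<partial>lborel)"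
    "(\<integral>x. (\<integral>y. (if y < x then \<bar>x - y\<bar> powr (s - 1) * (g x * g y) else 0) \<partial>lborel) \<partial>lborel) = riesz_energy s / 2"
    "integrable lborel (\<lambda>x. \<integral>y. (if x < y then \<bar>x - y\<bar> powr (s - 1) * (g x * g y) else 0) \<partial>lborel)"
    "(\<integral>x. (\<integral>y. (if x < y then \<bar>x - y\<bar> powr (s - 1) * (g x * g y) else 0) \<partial>lborel) \<partial>lborel) = riesz_energy s / 2"
    using lborel_pair.integral_fst'[OF l] lborel_pair.integrable_fst'[OF l]
      lborel_pair.integral_fst'[OF r] lborel_pair.integrable_fst'[OF r]
    by (simp_all only:)
qed

text \<open>The addition formula for the cosine splits the double integral into two squares. This is
  the source of all positivity below.\<close>

lemma integral_cos_diff: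
  "(\<integral>z. cos (\<xi> * (fst z - snd z)) * (g (fst z) * g (snd z)) \<partial>(lborel \<Otimes>\<^sub>M lborel)) = power_spectrum \<xi>"
proof -
  have c: "integrable lborel (\<lambda>x. g x * cos (\<xi> * x))" and s: "integrable lborel (\<lambda>x. g x * sin (\<xi> * x))"
    by (auto intro!: integrable_g_mult)
  have "cos (\<xi> * (fst z - snd z)) * (g (fst z) * g (snd z)) =
      (g (fst z) * cos (\<xi> * fst z)) * (g (snd z) * cos (\<xi> * snd z)) +
      (g (fst z) * sin (\<xi> * fst z)) * (g (snd z) * sin (\<xi> * snd z))" for z
    by (simp add: right_diff_distrib cos_diff algebra_simps)
  then show ?thesis
    using lborel_pair.integrable_mult_pair[OF c c] lborel_pair.integrable_mult_pair[OF s s]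
      lborel_pair.integral_mult_pair[OF c c] lborel_pair.integral_mult_pair[OF s s]
    by (simp add: power_spectrum_def power2_eq_square)
qed

text \<open>Insert the cosine representation of the Gaussian and exchange integrals. The normal
  density times |g(x) g(y)| is an integrable majorant.\<close>

lemma gaussian_energy:
  assumes "t > 0"
  shows "has_bochner_integral lborel (\<lambda>\<xi>. normal_density 0 (sqrt (2 * t)) \<xi> * power_spectrum \<xi>)
    (\<integral>z. exp (- t * (fst z - snd z)\<^sup>2) * (g (fst z) * g (snd z)) \<partial>(lborel \<Otimes>\<^sub>M lborel))"
proof -
  interpret P: pair_sigma_finite "lborel :: real measure" "lborel \<Otimes>\<^sub>M lborel :: (real \<times> real) measure"
    by (rule pair_sigma_finite_lborel_3)
  let ?n = "normal_density 0 (sqrt (2 * t))"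
  let ?Q = "\<lambda>\<xi> z. ?n \<xi> * (cos (\<xi> * (fst z - snd z)) * (g (fst z) * g (snd z)))"
  have n: "integrable lborel ?n"
    using assms by (intro integrable_normal_density) simp
  have gg: "integrable (lborel \<Otimes>\<^sub>M lborel) (\<lambda>z. g (fst z) * g (snd z))"
    by (rule lborel_pair.integrable_mult_pair[OF integrable_g integrable_g])
  have Q: "integrable (lborel \<Otimes>\<^sub>M (lborel \<Otimes>\<^sub>M lborel)) (case_prod ?Q)"
  proof (rule Bochner_Integration.integrable_bound[OF P.integrable_mult_pair[OF n gg]])
    show "AE z in lborel \<Otimes>\<^sub>M lborel \<Otimes>\<^sub>M lborel. norm (case_prod ?Q z)
        \<le> norm (?n (fst z) * (g (fst (snd z)) * g (snd (snd z))))"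
      by (intro AE_I2) (auto simp: case_prod_beta' abs_mult intro!: mult_left_mono mult_left_le_one_le)
  qed (simp add: normal_density_def)
  have "(\<integral>\<xi>. ?Q \<xi> z \<partial>lborel) = exp (- t * (fst z - snd z)\<^sup>2) * (g (fst z) * g (snd z))" for z
    using has_bochner_integral_integral_eq[OF has_bochner_integral_normal_cos[OF assms, of "fst z - snd z"]]
    by (simp flip: mult.assoc)
  moreover have "(\<integral>z. ?Q \<xi> z \<partial>(lborel \<Otimes>\<^sub>M lborel)) = ?n \<xi> * power_spectrum \<xi>" for \<xi>
    by (simp add: integral_cos_diff)
  ultimately show ?thesis
    using P.Fubini_integral[OF Q] P.integrable_fst[OF Q] by (simp only: has_bochner_integral_iff simp_thms)
qed

text \<open>The exponent \<open>a\<close> is chosen so that (x - y)^2 to the power -a is |x - y| to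
  the power s - 1, and s < 1 makes it positive.\<close>

lemma riesz_energy_eq_gaussian_mixture:
  assumes "0 < s" "s < 1"
  defines "a \<equiv> (1 - s) / 2"
  shows "has_bochner_integral lborel (\<lambda>t. indicator {0<..} t * t powr (a - 1) *
      (\<integral>z. exp (- t * (fst z - snd z)\<^sup>2) * (g (fst z) * g (snd z)) \<partial>(lborel \<Otimes>\<^sub>M lborel)))
    (Gamma a * riesz_energy s)"
proof -
  interpret P: pair_sigma_finite "lborel \<Otimes>\<^sub>M lborel :: (real \<times> real) measure" "lborel :: real measure"
    by (rule pair_sigma_finite_lborel_3)
  have a: "a > 0" using assms by simp
  let ?k = "\<lambda>z. \<bar>fst z - snd z\<bar> powr (s - 1) * (g (fst z) * g (snd z))"
  let ?Q = "\<lambda>z t. (indicator {0<..} t * t powr (a - 1) * exp (- t * (fst z - snd z)\<^sup>2)) * (g (fst z) * g (snd z))"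
  \<comment> \<open>The Gamma formula requires x - y to be nonzero, so the diagonal is discarded as
    a null set.\<close>
  have ne: "AE z in lborel \<Otimes>\<^sub>M lborel. fst z \<noteq> (snd z :: real)"
  proof (rule lborel_pair.AE_pair_measure)
    show "AE x in lborel. AE y in lborel. fst (x, y) \<noteq> (snd (x, y) :: real)"
    proof (rule AE_I2)
      fix x :: real
      show "AE y in lborel. fst (x, y) \<noteq> snd (x, y)"
        using AE_lborel_singleton[of x] by eventually_elim auto
    qed
  qed measurable
  have *: "has_bochner_integral lborel (\<lambda>t. indicator {0<..} t * t powr (a - 1) * exp (- t * (fst z - snd z)\<^sup>2))
      (Gamma a * \<bar>fst z - snd z\<bar> powr (s - 1))" if "fst z \<noteq> snd z" for z :: "real \<times> real"
  proof -
    have "(fst z - snd z)\<^sup>2 powr - a = (\<bar>fst z - snd z\<bar> powr 2) powr - a"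
      using that by simp
    also have "\<dots> = \<bar>fst z - snd z\<bar> powr (2 * - a)"
      by (rule powr_powr)
    also have "2 * - a = s - 1" by (simp add: a_def field_simps)
    finally show ?thesis
      using has_bochner_integral_Gamma_scaled[OF a, of "(fst z - snd z)\<^sup>2"] that by simp
  qed
  \<comment> \<open>The weight in t is nonnegative, so the integral of the norm is known exactly
    too. This supplies the integrability for Fubini.\<close>
  have Q1: "integrable lborel (?Q z)" "(\<integral>t. ?Q z t \<partial>lborel) = Gamma a * ?k z"
    "(\<integral>t. norm (?Q z t) \<partial>lborel) = Gamma a * norm (?k z)" if "fst z \<noteq> snd z" for z
  proof -
    show "integrable lborel (?Q z)" "(\<integral>t. ?Q z t \<partial>lborel) = Gamma a * ?k z"
      using *[OF that] by (simp_all add: has_bochner_integral_iff)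
    have "norm (?Q z t) = (indicator {0<..} t * t powr (a - 1) * exp (- t * (fst z - snd z)\<^sup>2)) * \<bar>g (fst z) * g (snd z)\<bar>" for t
      by (simp add: abs_mult)
    then show "(\<integral>t. norm (?Q z t) \<partial>lborel) = Gamma a * norm (?k z)"
      using *[OF that] by (simp add: has_bochner_integral_iff abs_mult)
  qed
  have k: "integrable (lborel \<Otimes>\<^sub>M lborel) ?k"
    by (rule integrable_riesz_fst_snd[OF \<open>0 < s\<close>])
  have Q: "integrable ((lborel \<Otimes>\<^sub>M lborel) \<Otimes>\<^sub>M lborel) (case_prod ?Q)"
  proof (rule P.Fubini_integrable)
    show [measurable]: "case_prod ?Q \<in> borel_measurable ((lborel \<Otimes>\<^sub>M lborel) \<Otimes>\<^sub>M lborel)"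
      by measurable
    have "integrable (lborel \<Otimes>\<^sub>M lborel) (\<lambda>z. Gamma a * norm (?k z))"
      by (intro Bochner_Integration.integrable_mult_right integrable_norm k)
    then show "integrable (lborel \<Otimes>\<^sub>M lborel) (\<lambda>z. \<integral>t. norm (case_prod ?Q (z, t)) \<partial>lborel)"
    proof (rule Bochner_Integration.integrable_cong_AE_imp)
      show "AE z in lborel \<Otimes>\<^sub>M lborel. Gamma a * norm (?k z) = (\<integral>t. norm (case_prod ?Q (z, t)) \<partial>lborel)"
        using ne by eventually_elim (simp only: prod.case, rule Q1(3)[symmetric])
    qed measurable
    show "AE z in lborel \<Otimes>\<^sub>M lborel. integrable lborel (\<lambda>t. case_prod ?Q (z, t))"
      using ne by eventually_elim (simp only: prod.case, rule Q1(1))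
  qed
  have "(\<integral>z. (\<integral>t. ?Q z t \<partial>lborel) \<partial>(lborel \<Otimes>\<^sub>M lborel)) = (\<integral>z. Gamma a * ?k z \<partial>(lborel \<Otimes>\<^sub>M lborel))"
  proof (rule integral_cong_AE)
    show "AE z in lborel \<Otimes>\<^sub>M lborel. (\<integral>t. ?Q z t \<partial>lborel) = Gamma a * ?k z"
      using ne by eventually_elim (rule Q1(2))
  qed measurable
  also have "\<dots> = Gamma a * riesz_energy s"
    by (simp add: riesz_energy_def)
  finally have "(\<integral>t. (\<integral>z. ?Q z t \<partial>(lborel \<Otimes>\<^sub>M lborel)) \<partial>lborel) = Gamma a * riesz_energy s"
    using P.Fubini_integral[OF Q] by simp
  moreover have "integrable lborel (\<lambda>t. \<integral>z. ?Q z t \<partial>(lborel \<Otimes>\<^sub>M lborel))"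
    by (rule P.integrable_snd[OF Q])
  moreover have "(\<integral>z. ?Q z t \<partial>(lborel \<Otimes>\<^sub>M lborel)) = indicator {0<..} t * t powr (a - 1) *
      (\<integral>z. exp (- t * (fst z - snd z)\<^sup>2) * (g (fst z) * g (snd z)) \<partial>(lborel \<Otimes>\<^sub>M lborel))" for t
    by (simp only: mult.assoc integral_mult_right_zero)
  ultimately show ?thesis by (simp add: has_bochner_integral_iff)
qed

end

text \<open>Each factor is replaced by its minimum on the interval. Since a < 1, the power of t is
  smallest at t = 2\<xi>^2, as is the density prefactor, giving 1 / sqrt(8 pi \<xi>^2). The
  exponential is smallest at t = \<xi>^2, giving exp(-1/4).\<close>

lemma gaussian_weight_lower_bound:
  fixes a s \<xi> t :: real
  assumes "0 < s" and a: "a = (1 - s) / 2" and \<xi>: "\<xi> \<noteq> 0" and t: "\<xi>\<^sup>2 \<le> t" "t \<le> 2 * \<xi>\<^sup>2"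
  shows "2 powr (a - 1) / sqrt (8 * pi) * exp (- 1 / 4) * \<bar>\<xi>\<bar> powr (- s - 2) \<le>
     t powr (a - 1) * normal_density 0 (sqrt (2 * t)) \<xi>"
proof -
  have t0: "t > 0" using \<xi> t by (meson less_le_trans zero_less_power2)
  have "2 powr (a - 1) / sqrt (8 * pi) * exp (- 1 / 4) * \<bar>\<xi>\<bar> powr (- s - 2) =
      (2 * \<xi>\<^sup>2) powr (a - 1) * (1 / sqrt (8 * pi * \<xi>\<^sup>2) * exp (- 1 / 4))"
  proof -
    have "(2 * \<xi>\<^sup>2) powr (a - 1) = 2 powr (a - 1) * (\<bar>\<xi>\<bar> powr 2) powr (a - 1)"
      using \<xi> by (simp add: powr_mult)
    also have "(\<bar>\<xi>\<bar> powr 2) powr (a - 1) = \<bar>\<xi>\<bar> powr ((- s - 2) + 1)"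
    proof -
      have "2 * (a - 1) = (- s - 2) + 1" by (simp add: a field_simps)
      then show ?thesis unfolding powr_powr by (rule arg_cong)
    qed
    also have "\<dots> = \<bar>\<xi>\<bar> powr (- s - 2) * \<bar>\<xi>\<bar>"
      using \<xi> by (subst powr_add) simp
    finally show ?thesis
      using \<xi> by (simp add: real_sqrt_mult[of _ "\<xi>\<^sup>2"])
  qed
  also have "\<dots> \<le> t powr (a - 1) * (1 / sqrt (2 * pi * (sqrt (2 * t))\<^sup>2) * exp (- (\<xi> - 0)\<^sup>2 / (2 * (sqrt (2 * t))\<^sup>2)))"
  proof (intro mult_mono)
    show "(2 * \<xi>\<^sup>2) powr (a - 1) \<le> t powr (a - 1)"
      using t t0 \<open>0 < s\<close> by (intro powr_mono2') (auto simp: a field_simps)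
    show "1 / sqrt (8 * pi * \<xi>\<^sup>2) \<le> 1 / sqrt (2 * pi * (sqrt (2 * t))\<^sup>2)"
      using \<xi> t t0 by (intro divide_left_mono) (auto simp: zero_less_mult_iff)
    show "exp (- 1 / 4) \<le> exp (- (\<xi> - 0)\<^sup>2 / (2 * (sqrt (2 * t))\<^sup>2))"
      using t t0 by (simp add: field_simps)
  qed auto
  finally show ?thesis by (simp add: normal_density_def)
qed

section \<open>Lower bound of the Riesz energy by the weighted power spectrum\<close>

context cutoff_function
begin

text \<open>Restricting the \<open>t\<close>-integral to \<open>[\<xi>\<^sup>2, 2\<xi>\<^sup>2]\<close> already gives the homogeneity \<open>|\<xi>|\<^sup>-\<^sup>s\<close>,
  so the exact value of the integral is not needed.\<close>

lemma nn_integral_gaussian_weight_ge: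
  fixes a s \<xi> :: real
  assumes "0 < s" and a: "a = (1 - s) / 2"
  shows "ennreal (2 powr (a - 1) / sqrt (8 * pi) * exp (- 1 / 4) * (\<bar>\<xi>\<bar> powr - s * power_spectrum \<xi>)) \<le>
    (\<integral>\<^sup>+t. ennreal (indicator {0<..} t * t powr (a - 1) * (normal_density 0 (sqrt (2 * t)) \<xi> * power_spectrum \<xi>)) \<partial>lborel)"
\<comment> \<open>At \<xi> = 0 the left side is 0 because \<open>0 powr (- s)\<close> is 0.\<close>
proof (cases "\<xi> = 0")
  case False
  define C where "C = 2 powr (a - 1) / sqrt (8 * pi) * exp (- 1 / 4)"
  have C: "C \<ge> 0" by (simp add: C_def)
  \<comment> \<open>The factor \<xi>^2 split off here is the length of the interval of integration
    in t.\<close>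
  have "C * (\<bar>\<xi>\<bar> powr - s * power_spectrum \<xi>) = C * \<bar>\<xi>\<bar> powr (- s - 2) * power_spectrum \<xi> * \<xi>\<^sup>2"
  proof -
    have p: "\<bar>\<xi>\<bar> powr (- s - 2) * \<bar>\<xi>\<bar> powr 2 = \<bar>\<xi>\<bar> powr - s"
      by (subst powr_add[symmetric]) simp
    have "\<bar>\<xi>\<bar> powr 2 = \<xi>\<^sup>2"
      using False by simp
    from p have "\<bar>\<xi>\<bar> powr (- s - 2) * \<xi>\<^sup>2 = \<bar>\<xi>\<bar> powr - s"
      unfolding \<open>\<bar>\<xi>\<bar> powr 2 = \<xi>\<^sup>2\<close> .
    then show ?thesis by (metis mult.assoc mult.commute)
  qed
  then have "ennreal (C * (\<bar>\<xi>\<bar> powr - s * power_spectrum \<xi>)) =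
      ennreal (C * \<bar>\<xi>\<bar> powr (- s - 2) * power_spectrum \<xi>) * ennreal (\<xi>\<^sup>2)"
    by (simp only:) (intro ennreal_mult mult_nonneg_nonneg C power_spectrum_nonneg powr_ge_zero zero_le_power2)
  also have "\<dots> = (\<integral>\<^sup>+t. ennreal (C * \<bar>\<xi>\<bar> powr (- s - 2) * power_spectrum \<xi>) * indicator {\<xi>\<^sup>2..2 * \<xi>\<^sup>2} t \<partial>lborel)"
    by (simp add: nn_integral_cmult_indicator)
  also have "\<dots> \<le> (\<integral>\<^sup>+t. ennreal (indicator {0<..} t * t powr (a - 1) *
      (normal_density 0 (sqrt (2 * t)) \<xi> * power_spectrum \<xi>)) \<partial>lborel)"
  proof (intro nn_integral_mono)
    fix t :: real
    show "ennreal (C * \<bar>\<xi>\<bar> powr (- s - 2) * power_spectrum \<xi>) * indicator {\<xi>\<^sup>2..2 * \<xi>\<^sup>2} t \<le>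
      ennreal (indicator {0<..} t * t powr (a - 1) * (normal_density 0 (sqrt (2 * t)) \<xi> * power_spectrum \<xi>))"
    proof (cases "\<xi>\<^sup>2 \<le> t \<and> t \<le> 2 * \<xi>\<^sup>2")
      case True
      then have "t > 0" using False by (meson less_le_trans zero_less_power2)
      have "C * \<bar>\<xi>\<bar> powr (- s - 2) * power_spectrum \<xi> \<le>
          t powr (a - 1) * normal_density 0 (sqrt (2 * t)) \<xi> * power_spectrum \<xi>"
        unfolding C_def
        by (intro mult_right_mono gaussian_weight_lower_bound power_spectrum_nonneg)
          (use assms False True in auto)
      then show ?thesis
        using True \<open>t > 0\<close> by (simp add: mult.assoc ennreal_leI)
    qed auto
  qed
  finally show ?thesis by (simp only: C_def)
qed simp

lemma gaussian_energy_nonneg: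
  "0 \<le> indicator {0<..} t *
     (\<integral>z. exp (- t * (fst z - snd z)\<^sup>2) * (g (fst z) * g (snd z)) \<partial>(lborel \<Otimes>\<^sub>M lborel))"
proof (cases "t > 0")
  case True
  have "0 \<le> (\<integral>\<xi>. normal_density 0 (sqrt (2 * t)) \<xi> * power_spectrum \<xi> \<partial>lborel)"
    by (intro Bochner_Integration.integral_nonneg) (simp add: power_spectrum_nonneg normal_density_nonneg)
  then show ?thesis
    unfolding has_bochner_integral_integral_eq[OF gaussian_energy[OF True]] by simp
qed simp

text \<open>Tonelli's theorem exchanges the integrals in t and \<xi>. Integrability of the weighted
  spectrum is not known beforehand, hence the form with nonnegative integrals; it will follow from
  this bound.\<close>

lemma nn_integral_power_spectrum_le_riesz_energy:
  fixes a s :: real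
  assumes s: "0 < s" "s < 1" and a: "a = (1 - s) / 2"
  shows "(\<integral>\<^sup>+\<xi>. ennreal (2 powr (a - 1) / sqrt (8 * pi) * exp (- 1 / 4) * (\<bar>\<xi>\<bar> powr - s * power_spectrum \<xi>)) \<partial>lborel)
    \<le> ennreal (Gamma a * riesz_energy s)"
proof -
  let ?q = "\<lambda>t \<xi>. indicator {0<..} t * t powr (a - 1) * (normal_density 0 (sqrt (2 * t)) \<xi> * power_spectrum \<xi>)"
  let ?F = "\<lambda>t. indicator {0<..} t * t powr (a - 1) *
      (\<integral>z. exp (- t * (fst z - snd z)\<^sup>2) * (g (fst z) * g (snd z)) \<partial>(lborel \<Otimes>\<^sub>M lborel))"
  have q_nonneg: "?q t \<xi> \<ge> 0" for t \<xi>
    by (simp add: power_spectrum_nonneg normal_density_nonneg)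
  have q: "has_bochner_integral lborel (?q t) (?F t)" for t
  proof (cases "t > 0")
    case True
    then show ?thesis by (intro has_bochner_integral_mult_right gaussian_energy)
  qed (simp add: has_bochner_integral_zero)
  have F: "has_bochner_integral lborel ?F (Gamma a * riesz_energy s)"
    unfolding a by (rule riesz_energy_eq_gaussian_mixture[OF s])
  have "(\<integral>\<^sup>+\<xi>. ennreal (2 powr (a - 1) / sqrt (8 * pi) * exp (- 1 / 4) * (\<bar>\<xi>\<bar> powr - s * power_spectrum \<xi>)) \<partial>lborel)
      \<le> (\<integral>\<^sup>+\<xi>. (\<integral>\<^sup>+t. ennreal (?q t \<xi>) \<partial>lborel) \<partial>lborel)"
    by (intro nn_integral_mono nn_integral_gaussian_weight_ge[OF s(1) a])
  also have "\<dots> = (\<integral>\<^sup>+t. (\<integral>\<^sup>+\<xi>. ennreal (?q t \<xi>) \<partial>lborel) \<partial>lborel)"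
    by (rule lborel_pair.Fubini') (simp add: normal_density_def)
  also have "\<dots> = (\<integral>\<^sup>+t. ennreal (?F t) \<partial>lborel)"
  proof (rule nn_integral_cong)
    fix t
    have "(\<integral>\<^sup>+\<xi>. ennreal (?q t \<xi>) \<partial>lborel) = ennreal (\<integral>\<xi>. ?q t \<xi> \<partial>lborel)"
      by (intro nn_integral_eq_integral AE_I2 q_nonneg integrable.intros[OF q])
    then show "(\<integral>\<^sup>+\<xi>. ennreal (?q t \<xi>) \<partial>lborel) = ennreal (?F t)"
      by (simp only: has_bochner_integral_integral_eq[OF q])
  qed
  also have "\<dots> = ennreal (Gamma a * riesz_energy s)"
  proof -
    have "(\<integral>\<^sup>+t. ennreal (?F t) \<partial>lborel) = ennreal (\<integral>t. ?F t \<partial>lborel)"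
    proof (intro nn_integral_eq_integral AE_I2 integrable.intros[OF F])
      fix t show "?F t \<ge> 0"
        using gaussian_energy_nonneg[of t] by (cases "t > 0") auto
    qed
    then show ?thesis
      by (simp only: has_bochner_integral_integral_eq[OF F])
  qed
  finally show ?thesis .
qed

text \<open>\<open>ennreal\<close> sends negative reals to 0, so the preceding bound can be read as
  one between reals only once the energy is known to be nonnegative.\<close>

lemma riesz_energy_nonneg:
  assumes "0 < s" "s < 1"
  shows "riesz_energy s \<ge> 0"
proof -
  let ?a = "(1 - s) / 2"
  let ?E = "\<lambda>t. indicator {0<..} t * t powr (?a - 1) *
      (\<integral>z. exp (- t * (fst z - snd z)\<^sup>2) * (g (fst z) * g (snd z)) \<partial>(lborel \<Otimes>\<^sub>M lborel))"
  have "0 \<le> (\<integral>t. ?E t \<partial>lborel)"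
  proof (rule Bochner_Integration.integral_nonneg)
    fix t show "?E t \<ge> 0"
      using gaussian_energy_nonneg[of t] by (cases "t > 0") auto
  qed
  also have "\<dots> = Gamma ?a * riesz_energy s"
    by (rule has_bochner_integral_integral_eq[OF riesz_energy_eq_gaussian_mixture[OF assms]])
  finally have "0 \<le> Gamma ?a * riesz_energy s" .
  moreover have "Gamma ?a > 0" using assms by (intro Gamma_real_pos) simp
  ultimately show ?thesis by (simp add: zero_le_mult_iff)
qed

end

section \<open>Coercivity\<close>

locale continuous_cutoff = cutoff_function "\<lambda>x. indicator {-1..1} x * w x" M
  for w :: "real \<Rightarrow> real" and M :: real +
  assumes w_cont: "continuous_on UNIV w"
begin

lemma w_measurable: "w \<in> borel_measurable borel"
  by (rule borel_measurable_continuous_onI[OF w_cont])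

text \<open>Bridge between Lebesgue integrals of the cut-off function and the gauge integrals over
  [-1, 1] in which \<open>Fc\<close> and the bilinear form are stated.\<close>

lemma integral_cutoff_mult:
  fixes h :: "real \<Rightarrow> real"
  assumes "h \<in> borel_measurable borel" "\<And>x. \<bar>h x\<bar> \<le> 1"
  shows "(\<integral>x. indicator {-1..1} x * w x * h x \<partial>lborel) = integral {-1..1} (\<lambda>x. w x * h x)"
proof -
  have "integral UNIV (\<lambda>x. indicator {-1..1} x * w x * h x) = integral UNIV (\<lambda>x. if x \<in> {-1..1} then w x * h x else 0)"
    by (intro integral_cong) (simp add: indicator_def)
  then show ?thesis
    using integral_lborel[OF integrable_g_mult[OF assms]] by (simp only: integral_restrict_UNIV)
qed

lemma norm_Fc: "(cmod (Fc w \<xi>))\<^sup>2 = power_spectrum \<xi> / (4 * pi\<^sup>2)"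
proof -
  have w: "continuous_on {-1..1} w" using w_cont continuous_on_subset by blast
  define c where "c = integral {-1..1} (\<lambda>x. w x * cos (\<xi> * x))"
  define s where "s = integral {-1..1} (\<lambda>x. w x * sin (\<xi> * x))"
  have "((\<lambda>x. w x * cos (\<xi> * x)) has_integral c) {-1..1}" "((\<lambda>x. w x * sin (\<xi> * x)) has_integral s) {-1..1}"
    unfolding c_def s_def
    by (auto intro!: integrable_integral integrable_continuous_interval continuous_intros w)
  then have "((\<lambda>x. complex_of_real (w x * cos (\<xi> * x)) + \<i> * complex_of_real (w x * sin (\<xi> * x)))
      has_integral complex_of_real c + \<i> * complex_of_real s) {-1..1}"
    by (intro has_integral_add has_integral_mult_right)
      (auto dest: has_integral_linear[OF _ bounded_linear_of_real] simp: o_def)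
  moreover have "complex_of_real (w x * cos (\<xi> * x)) + \<i> * complex_of_real (w x * sin (\<xi> * x)) =
      complex_of_real (w x) * exp (\<i> * complex_of_real (\<xi> * x))" for x
    by (simp add: exp_Euler cos_of_real sin_of_real algebra_simps flip: of_real_mult)
  ultimately have "Fc w \<xi> = (complex_of_real c + \<i> * complex_of_real s) / complex_of_real (2 * pi)"
    by (simp add: Fc_def integral_unique)
  then have "(cmod (Fc w \<xi>))\<^sup>2 = (c\<^sup>2 + s\<^sup>2) / (2 * pi)\<^sup>2"
    by (simp add: norm_divide power_divide cmod_power2)
  moreover have "power_spectrum \<xi> = c\<^sup>2 + s\<^sup>2"
    by (simp add: power_spectrum_def integral_cutoff_mult c_def s_def)
  ultimately show ?thesis by (simp add: power_mult_distrib)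
qed

text \<open>Squaring the weight of order s / 2 gives |\<xi>| to the power -s. The factor 4 pi^2
  compensates the normalisation of \<open>Fc\<close>.\<close>

lemma Jneg_norm_le_riesz_energy:
  fixes s :: real
  assumes s: "0 < s" "s < 1"
  shows "2 powr ((1 - s) / 2 - 1) / sqrt (8 * pi) * exp (- 1 / 4) * (4 * pi\<^sup>2) * (Jneg_norm (s / 2) w)\<^sup>2 \<le>
    Gamma ((1 - s) / 2) * riesz_energy s"
proof -
  define C where "C = 2 powr ((1 - s) / 2 - 1) / sqrt (8 * pi) * exp (- 1 / 4)"
  define R where "R = Gamma ((1 - s) / 2) * riesz_energy s"
  define h where "h = (\<lambda>\<xi>. C * (\<bar>\<xi>\<bar> powr - s * power_spectrum \<xi>))"
  have C: "C > 0" by (simp add: C_def)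
  have R: "R \<ge> 0"
    unfolding R_def using riesz_energy_nonneg[OF s] s by (intro mult_nonneg_nonneg less_imp_le[OF Gamma_real_pos]) auto
  have h_nonneg: "h \<xi> \<ge> 0" for \<xi>
    using C by (simp add: h_def power_spectrum_nonneg)
  have nn: "(\<integral>\<^sup>+\<xi>. ennreal (h \<xi>) \<partial>lborel) \<le> ennreal R"
    unfolding h_def C_def R_def by (rule nn_integral_power_spectrum_le_riesz_energy[OF s refl])
  \<comment> \<open>The finite upper bound yields integrability, which identifies the gauge integral
    in \<open>Jneg_norm\<close> with the Lebesgue integral.\<close>
  have h: "integrable lborel h"
  proof (rule integrableI_nonneg)
    show "(\<integral>\<^sup>+\<xi>. ennreal (h \<xi>) \<partial>lborel) < \<infinity>"
      using nn by (simp add: le_less_trans)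
  qed (use h_nonneg in \<open>auto simp: h_def[abs_def]\<close>)
  have "ennreal (\<integral>\<xi>. h \<xi> \<partial>lborel) \<le> ennreal R"
    using nn nn_integral_eq_integral[OF h] h_nonneg by simp
  then have le: "(\<integral>\<xi>. h \<xi> \<partial>lborel) \<le> R"
    using R by simp
  have "C * (4 * pi\<^sup>2) * (\<bar>\<xi>\<bar> powr (- (s / 2)) * cmod (Fc w \<xi>))\<^sup>2 = h \<xi>" for \<xi>
  proof -
    have "(\<bar>\<xi>\<bar> powr (- (s / 2)))\<^sup>2 = \<bar>\<xi>\<bar> powr - s"
      by (simp add: power2_eq_square flip: powr_add)
    then show ?thesis by (simp add: power_mult_distrib norm_Fc h_def)
  qed
  then have "C * (4 * pi\<^sup>2) * integral UNIV (\<lambda>\<xi>. (\<bar>\<xi>\<bar> powr (- (s / 2)) * cmod (Fc w \<xi>))\<^sup>2) = integral UNIV h"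
    by (simp flip: integral_mult_right)
  also have "integral UNIV h = (\<integral>\<xi>. h \<xi> \<partial>lborel)"
    by (rule integral_lborel[OF h])
  finally have eq: "C * (4 * pi\<^sup>2) * integral UNIV (\<lambda>\<xi>. (\<bar>\<xi>\<bar> powr (- (s / 2)) * cmod (Fc w \<xi>))\<^sup>2) = (\<integral>\<xi>. h \<xi> \<partial>lborel)" .
  \<comment> \<open>Squaring the square root in \<open>Jneg_norm\<close> returns the integral once
    that is known to be nonnegative.\<close>
  have "(\<integral>\<xi>. h \<xi> \<partial>lborel) \<ge> 0"
    by (intro Bochner_Integration.integral_nonneg h_nonneg)
  with eq have "C * (4 * pi\<^sup>2) * integral UNIV (\<lambda>\<xi>. (\<bar>\<xi>\<bar> powr (- (s / 2)) * cmod (Fc w \<xi>))\<^sup>2) \<ge> 0"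
    by simp
  moreover have "C * (4 * pi\<^sup>2) > 0" using C by simp
  ultimately have "integral UNIV (\<lambda>\<xi>. (\<bar>\<xi>\<bar> powr (- (s / 2)) * cmod (Fc w \<xi>))\<^sup>2) \<ge> 0"
    by (simp only: zero_le_mult_iff) linarith
  then show ?thesis
    unfolding C_def[symmetric] R_def[symmetric] using le eq by (simp add: Jneg_norm_def)
qed

text \<open>Serves both triangles: \<open>P\<close> is y < x or x < y, and \<open>S\<close> is the
  matching closed part of [-1, 1]. The extra point y = x contributes 0, since
  \<open>0 powr (s - 1)\<close> is 0.\<close>

lemma integral_riesz_section:
  assumes "s > 0" and [measurable]: "Measurable.pred borel P" and x: "x \<in> {-1..1}"
    and P: "\<And>y. y \<in> S \<longleftrightarrow> y \<in> {-1..1} \<and> (y = x \<or> P y)"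
  shows "(\<integral>y. (if P y then \<bar>x - y\<bar> powr (s - 1) * (indicator {-1..1} x * w x * (indicator {-1..1} y * w y)) else 0)
      \<partial>lborel) = w x * integral S (\<lambda>y. \<bar>x - y\<bar> powr (s - 1) * w y)"
proof -
  let ?k = "\<lambda>y. if P y then \<bar>x - y\<bar> powr (s - 1) * (indicator {-1..1} x * w x * (indicator {-1..1} y * w y)) else 0"
  have "integrable lborel ?k"
  proof (rule Bochner_Integration.integrable_bound[OF integrable_riesz_section[OF assms(1), of x]])
    show "?k \<in> borel_measurable lborel" using w_measurable by measurable
  qed auto
  then have "(\<integral>y. ?k y \<partial>lborel) = integral UNIV ?k"
    by (rule integral_lborel[symmetric])
  also have "integral UNIV ?k = integral UNIV (\<lambda>y. if y \<in> S then w x * (\<bar>x - y\<bar> powr (s - 1) * w y) else 0)"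
    using x by (intro integral_cong) (auto simp: P indicator_def)
  finally show ?thesis
    by (simp only: integral_restrict_UNIV integral_mult_right)
qed

text \<open>The y-sections over y < x assemble to one triangle of the energy. The factor
  \<open>Gamma s\<close> undoes the normalisation of \<open>leftI\<close>.\<close>

lemma integral_leftI_mult:
  assumes "s > 0"
  shows "Gamma s * integral {-1..1} (\<lambda>x. leftI s w x * w x) = riesz_energy s / 2"
proof -
  let ?g = "\<lambda>x. indicator {-1..1} x * w x"
  let ?k = "\<lambda>x y. \<bar>x - y\<bar> powr (s - 1) * (?g x * ?g y)"
  let ?h = "\<lambda>x. if x \<in> {-1..1} then Gamma s * (leftI s w x * w x) else 0"
  have G: "Gamma s \<noteq> 0" using Gamma_real_pos[OF assms] by simp
  have "(\<integral>y. (if y < x then ?k x y else 0) \<partial>lborel) = ?h x" for x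
  proof (cases "x \<in> {-1..1}")
    case True
    have "integral {-1..x} (\<lambda>y. \<bar>x - y\<bar> powr (s - 1) * w y) = Gamma s * leftI s w x"
      using G by (auto simp: leftI_def intro!: integral_cong)
    moreover have "(\<integral>y. (if y < x then ?k x y else 0) \<partial>lborel) =
        w x * integral {-1..x} (\<lambda>y. \<bar>x - y\<bar> powr (s - 1) * w y)"
      by (rule integral_riesz_section[OF assms _ True]) (use True in auto)
    ultimately show ?thesis using True by simp
  next
    case False
    then have i: "indicator {-1..1} x = (0 :: real)" by simp
    show ?thesis unfolding i if_not_P[OF False] by (simp cong: if_cong)
  qed
  with riesz_triangle(1,2)[OF assms]
  have h: "integrable lborel ?h" and eq: "(\<integral>x. ?h x \<partial>lborel) = riesz_energy s / 2"
    by (simp_all only:)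
  from trans[OF integral_lborel[OF h] eq] show ?thesis
    by (simp only: integral_restrict_UNIV integral_mult_right)
qed

lemma integral_rightI_mult:
  assumes "s > 0"
  shows "Gamma s * integral {-1..1} (\<lambda>x. rightI s w x * w x) = riesz_energy s / 2"
proof -
  let ?g = "\<lambda>x. indicator {-1..1} x * w x"
  let ?k = "\<lambda>x y. \<bar>x - y\<bar> powr (s - 1) * (?g x * ?g y)"
  let ?h = "\<lambda>x. if x \<in> {-1..1} then Gamma s * (rightI s w x * w x) else 0"
  have G: "Gamma s \<noteq> 0" using Gamma_real_pos[OF assms] by simp
  have "(\<integral>y. (if x < y then ?k x y else 0) \<partial>lborel) = ?h x" for x
  proof (cases "x \<in> {-1..1}")
    case True
    have "integral {x..1} (\<lambda>y. \<bar>x - y\<bar> powr (s - 1) * w y) = Gamma s * rightI s w x"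
      using G by (auto simp: rightI_def intro!: integral_cong)
    moreover have "(\<integral>y. (if x < y then ?k x y else 0) \<partial>lborel) =
        w x * integral {x..1} (\<lambda>y. \<bar>x - y\<bar> powr (s - 1) * w y)"
      by (rule integral_riesz_section[OF assms _ True]) (use True in auto)
    ultimately show ?thesis using True by simp
  next
    case False
    then have i: "indicator {-1..1} x = (0 :: real)" by simp
    show ?thesis unfolding i if_not_P[OF False] by (simp cong: if_cong)
  qed
  with riesz_triangle(3,4)[OF assms]
  have h: "integrable lborel ?h" and eq: "(\<integral>x. ?h x \<partial>lborel) = riesz_energy s / 2"
    by (simp_all only:)
  from trans[OF integral_lborel[OF h] eq] show ?thesis
    by (simp only: integral_restrict_UNIV integral_mult_right)
qed

end

lemma continuous_cutoff_exists:
  fixes w :: "real \<Rightarrow> real"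
  assumes w: "continuous_on UNIV w"
  obtains M where "continuous_cutoff w M"
proof -
  have "bounded (w ` {-1..1})"
    using w by (intro compact_imp_bounded compact_continuous_image) (auto intro: continuous_on_subset)
  then obtain M where M: "\<And>x. x \<in> {-1..1} \<Longrightarrow> norm (w x) \<le> M"
    by (meson bounded_iff imageI)
  have "continuous_cutoff w M"
  proof
    show "(\<lambda>x. indicator {-1..1} x * w x) \<in> borel_measurable borel"
      using borel_measurable_continuous_onI[OF w] by measurable
    show "\<bar>indicator {-1..1} x * w x\<bar> \<le> M * indicator {-1..1} x" for x
      using M[of x] by (simp add: indicator_def)
  qed (rule w)
  then show ?thesis by (rule that)
qed

text \<open>Both \<mu> and \<nu> lie in (-1, 0] and cannot both be 0, as their sum is negative. So
  the numerator is negative, and so is the denominator, because sin(pi \<alpha>) = sin(pi (\<alpha>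
  - 2)).\<close>

lemma Calp_pos:
  assumes "1 < \<alpha>" "\<alpha> < 2" "\<alpha> - 2 \<le> \<mu>" "\<mu> \<le> 0" "\<alpha> - 2 \<le> \<nu>" "\<nu> \<le> 0" "\<mu> + \<nu> = \<alpha> - 2"
  shows "Calp \<alpha> \<mu> \<nu> > 0"
proof -
  have neg: "sin (pi * x) < 0" if "-1 < x" "x < 0" for x
  proof -
    have "0 < pi * (- x)" "pi * (- x) < pi * 1"
      using that by (intro mult_pos_pos mult_strict_left_mono; simp)+
    then show ?thesis using sin_gt_zero[of "pi * (- x)"] by simp
  qed
  have "sin (pi * \<mu>) \<le> 0" "sin (pi * \<nu>) \<le> 0"
    using neg[of \<mu>] neg[of \<nu>] assms by (cases "\<mu> = 0"; cases "\<nu> = 0"; force)+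
  moreover have "sin (pi * \<mu>) < 0 \<or> sin (pi * \<nu>) < 0"
    using neg[of \<mu>] neg[of \<nu>] assms by linarith
  ultimately have "sin (pi * \<mu>) + sin (pi * \<nu>) < 0" by linarith
  moreover have "sin (pi * \<alpha>) < 0"
    using neg[of "\<alpha> - 2"] assms sin_periodic[of "pi * (\<alpha> - 2)"] by (simp add: algebra_simps)
  ultimately show ?thesis by (simp add: Calp_def divide_neg_neg)
qed

text \<open>The reproducing kernels make the penalty products -u(-1) and u(1), with exactly the
  signs that cancel the boundary terms of the integration by parts.\<close>

lemma bilinA_self:
  fixes u :: "real poly"
  assumes \<alpha>: "1 < \<alpha>" "\<alpha> < 2" and deg: "degree u \<le> N"
    and Qm: "\<And>x. \<rho>m * Qm x = - (\<Sum>k\<le>N. legendre k x * legendre k (-1) / gamma00 k)"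
    and Qp: "\<And>x. \<rho>p * Qp x = (\<Sum>k\<le>N. legendre k x * legendre k 1 / gamma00 k)"
  shows "bilinA \<alpha> p \<mu> \<nu> c \<rho>m \<rho>p Qm Qp (poly u) (poly u) =
    Calp \<alpha> \<mu> \<nu> * (p * integral {-1..1} (\<lambda>x. leftI (2 - \<alpha>) (poly (pderiv u)) x * poly (pderiv u) x) +
      (1 - p) * integral {-1..1} (\<lambda>x. rightI (2 - \<alpha>) (poly (pderiv u)) x * poly (pderiv u) x))
    + c * integral {-1..1} (\<lambda>x. (poly u x)\<^sup>2)"
proof -
  let ?w = "poly (pderiv u)"
  let ?D = "caputoD \<alpha> p \<mu> \<nu> (poly u)"
  have s: "2 - \<alpha> > 0" using \<alpha> by simp
  have D: "?D = (\<lambda>x. Calp \<alpha> \<mu> \<nu> * (p * leftI (2 - \<alpha>) ?w x + (1 - p) * rightI (2 - \<alpha>) ?w x))"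
    by (rule ext) (simp add: caputoD_def)
  have D_cont: "continuous_on {-1..1} ?D"
    unfolding D by (intro continuous_intros continuous_on_leftI_poly continuous_on_rightI_poly s)
  have D_diff: "?D field_differentiable at x" if "x \<in> {-1<..<1}" for x
    unfolding D using that s
    by (intro derivative_intros field_differentiable_leftI_poly field_differentiable_rightI_poly) auto
  have "L2ip (deriv ?D) (poly u) = ?D 1 * poly u 1 - ?D (-1) * poly u (-1) - integral {-1..1} (\<lambda>x. ?D x * ?w x)"
    unfolding L2ip_def by (rule integral_deriv_mult) (auto intro: D_cont D_diff poly_DERIV continuous_intros)
  moreover have "\<rho>m * L2ip Qm (poly u) = - poly u (-1)"
  proof -
    have "\<rho>m * L2ip Qm (poly u) = integral {-1..1} (\<lambda>x. \<rho>m * Qm x * poly u x)"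
      by (simp add: L2ip_def mult.assoc)
    then show ?thesis
      using legendre_kernel_reproducing[OF deg, of "-1"] by (simp add: Qm)
  qed
  moreover have "\<rho>p * L2ip Qp (poly u) = poly u 1"
  proof -
    have "\<rho>p * L2ip Qp (poly u) = integral {-1..1} (\<lambda>x. \<rho>p * Qp x * poly u x)"
      by (simp add: L2ip_def mult.assoc)
    then show ?thesis
      using legendre_kernel_reproducing[OF deg, of 1] by (simp only: Qp)
  qed
  moreover have "integral {-1..1} (\<lambda>x. ?D x * ?w x) = Calp \<alpha> \<mu> \<nu> *
      (p * integral {-1..1} (\<lambda>x. leftI (2 - \<alpha>) ?w x * ?w x) +
      (1 - p) * integral {-1..1} (\<lambda>x. rightI (2 - \<alpha>) ?w x * ?w x))"
  proof (rule integral_unique)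
    have "((\<lambda>x. Calp \<alpha> \<mu> \<nu> * (p * (leftI (2 - \<alpha>) ?w x * ?w x) + (1 - p) * (rightI (2 - \<alpha>) ?w x * ?w x))) has_integral
      Calp \<alpha> \<mu> \<nu> * (p * integral {-1..1} (\<lambda>x. leftI (2 - \<alpha>) ?w x * ?w x) +
      (1 - p) * integral {-1..1} (\<lambda>x. rightI (2 - \<alpha>) ?w x * ?w x))) {-1..1}"
      by (intro has_integral_mult_right has_integral_add integrable_integral integrable_continuous_interval
          continuous_intros continuous_on_leftI_poly continuous_on_rightI_poly s)
    then show "((\<lambda>x. ?D x * ?w x) has_integral
      Calp \<alpha> \<mu> \<nu> * (p * integral {-1..1} (\<lambda>x. leftI (2 - \<alpha>) ?w x * ?w x) +
      (1 - p) * integral {-1..1} (\<lambda>x. rightI (2 - \<alpha>) ?w x * ?w x))) {-1..1}"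
      unfolding D by (simp add: algebra_simps)
  qed
  moreover have "L2ip (poly u) (poly u) = integral {-1..1} (\<lambda>x. (poly u x)\<^sup>2)"
    by (simp add: L2ip_def power2_eq_square)
  ultimately show ?thesis
    unfolding bilinA_def by (simp add: mult.commute[of \<rho>m] mult.commute[of \<rho>p] mult.assoc)
qed

theorem theorem4p3:
  fixes \<alpha> p c \<mu> \<nu> :: real
  assumes "1 < \<alpha>" "\<alpha> < 2" "0 \<le> p" "p \<le> 1" "0 \<le> c"
    and "\<alpha> - 2 \<le> \<mu>" "\<mu> \<le> 0" "\<alpha> - 2 \<le> \<nu>" "\<nu> \<le> 0" "\<mu> + \<nu> = \<alpha> - 2"
    and "p * sin (pi * \<mu>) = (1 - p) * sin (pi * \<nu>)"
  shows "\<exists>C>0. \<forall>(N::nat) (\<rho>m::real) (\<rho>p::real) (Qm::real \<Rightarrow> real) (Qp::real \<Rightarrow> real)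
           (f::real \<Rightarrow> real) (g1::real) (g2::real) (uN::real poly).
     1 \<le> N \<longrightarrow>
     (\<forall>x. \<rho>m * Qm x = - (\<Sum>k\<le>N. legendre k x * legendre k (-1) / gamma00 k)) \<longrightarrow>
     (\<forall>x. \<rho>p * Qp x = (\<Sum>k\<le>N. legendre k x * legendre k 1 / gamma00 k)) \<longrightarrow>
     degree uN \<le> N \<longrightarrow>
     (\<forall>v::real poly. degree v \<le> N \<longrightarrow>
        bilinA \<alpha> p \<mu> \<nu> c \<rho>m \<rho>p Qm Qp (poly uN) (poly v)
          = L2ip f (poly v) + g1 * \<rho>m * L2ip Qm (poly v) + g2 * \<rho>p * L2ip Qp (poly v)) \<longrightarrow>
     bilinA \<alpha> p \<mu> \<nu> c \<rho>m \<rho>p Qm Qp (poly uN) (poly uN)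
       \<ge> C * (Jneg_norm (1 - \<alpha> / 2) (poly (pderiv uN)))\<^sup>2"
proof -
  define s where "s = 2 - \<alpha>"
  have s: "0 < s" "s < 1" using assms by (auto simp: s_def)
  define a where "a = (1 - s) / 2"
  have G: "Gamma s > 0" "Gamma a > 0"
    using s by (auto intro!: Gamma_real_pos simp: a_def)
  have calp: "Calp \<alpha> \<mu> \<nu> > 0"
    by (rule Calp_pos) (use assms in auto)
  define K where "K = 2 powr (a - 1) / sqrt (8 * pi) * exp (- 1 / 4) * (4 * pi\<^sup>2)"
  have K: "K > 0" by (simp add: K_def)
  \<comment> \<open>\<open>K / Gamma a\<close> comes from the bound of the energy by the norm, and
    \<open>2 * Gamma s\<close> from each fractional integral carrying half of the energy.\<close>
  define C where "C = Calp \<alpha> \<mu> \<nu> * K / (2 * Gamma s * Gamma a)"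
  have C: "C > 0" using calp K G by (simp add: C_def)
  have bound: "bilinA \<alpha> p \<mu> \<nu> c \<rho>m \<rho>p Qm Qp (poly u) (poly u)
      \<ge> C * (Jneg_norm (1 - \<alpha> / 2) (poly (pderiv u)))\<^sup>2"
    if Qm: "\<And>x. \<rho>m * Qm x = - (\<Sum>k\<le>N. legendre k x * legendre k (-1) / gamma00 k)"
      and Qp: "\<And>x. \<rho>p * Qp x = (\<Sum>k\<le>N. legendre k x * legendre k 1 / gamma00 k)"
      and deg: "degree u \<le> N" for N \<rho>m \<rho>p Qm Qp and u :: "real poly"
  proof -
    let ?w = "poly (pderiv u)"
    have "continuous_on UNIV ?w" by (intro continuous_intros)
    then obtain M where "continuous_cutoff ?w M"
      by (rule continuous_cutoff_exists)
    then interpret continuous_cutoff ?w M .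
    let ?L = "integral {-1..1} (\<lambda>x. leftI s ?w x * ?w x)"
    let ?R = "integral {-1..1} (\<lambda>x. rightI s ?w x * ?w x)"
    let ?J = "(Jneg_norm (1 - \<alpha> / 2) ?w)\<^sup>2"
    have L: "?L = riesz_energy s / (2 * Gamma s)" and R: "?R = riesz_energy s / (2 * Gamma s)"
      using integral_leftI_mult[OF s(1)] integral_rightI_mult[OF s(1)] G by (simp_all add: field_simps)
    \<comment> \<open>The order of the norm matches because s / 2 = 1 - \<alpha> / 2.\<close>
    have "K * ?J \<le> Gamma a * riesz_energy s"
      using Jneg_norm_le_riesz_energy[OF s] by (simp add: K_def a_def s_def diff_divide_distrib)
    then have "K * ?J / Gamma a \<le> riesz_energy s"
      using G by (simp add: pos_divide_le_eq mult.commute)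
    then have "Calp \<alpha> \<mu> \<nu> / (2 * Gamma s) * (K * ?J / Gamma a) \<le>
        Calp \<alpha> \<mu> \<nu> / (2 * Gamma s) * riesz_energy s"
      by (rule mult_left_mono) (use calp G in auto)
    also have "Calp \<alpha> \<mu> \<nu> / (2 * Gamma s) * (K * ?J / Gamma a) = C * ?J"
      by (simp add: C_def)
    \<comment> \<open>Both one-sided terms are equal and the weights p and 1 - p sum to 1, so p
      drops out.\<close>
    also have "Calp \<alpha> \<mu> \<nu> / (2 * Gamma s) * riesz_energy s = Calp \<alpha> \<mu> \<nu> * (p * ?L + (1 - p) * ?R)"
    proof -
      have e: "p * r + (1 - p) * r = r" for r :: real by (simp add: algebra_simps)
      show ?thesis unfolding L R e by simp
    qed
    also have "\<dots> \<le> Calp \<alpha> \<mu> \<nu> * (p * ?L + (1 - p) * ?R) + c * integral {-1..1} (\<lambda>x. (poly u x)\<^sup>2)"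
    proof -
      have "0 \<le> integral {-1..1} (\<lambda>x. (poly u x)\<^sup>2)"
        by (intro Henstock_Kurzweil_Integration.integral_nonneg integrable_continuous_interval
            continuous_intros) auto
      then show ?thesis using \<open>0 \<le> c\<close> by simp
    qed
    also have "\<dots> = bilinA \<alpha> p \<mu> \<nu> c \<rho>m \<rho>p Qm Qp (poly u) (poly u)"
      using bilinA_self[OF \<open>1 < \<alpha>\<close> \<open>\<alpha> < 2\<close> deg Qm Qp, of p \<mu> \<nu> c] by (simp add: s_def)
    finally show ?thesis .
  qed
  show ?thesis
  proof (intro exI[of _ C] conjI C allI impI)
    fix N \<rho>m \<rho>p Qm Qp and u :: "real poly"
    assume "\<forall>x. \<rho>m * Qm x = - (\<Sum>k\<le>N. legendre k x * legendre k (-1) / gamma00 k)"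
      and "\<forall>x. \<rho>p * Qp x = (\<Sum>k\<le>N. legendre k x * legendre k 1 / gamma00 k)"
      and "degree u \<le> N"
    then show "bilinA \<alpha> p \<mu> \<nu> c \<rho>m \<rho>p Qm Qp (poly u) (poly u)
        \<ge> C * (Jneg_norm (1 - \<alpha> / 2) (poly (pderiv u)))\<^sup>2"
      by (intro bound) auto
  qed
qed

end
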